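(* There is a polynomial-time algorithm and a function $\varepsilon:\mathbb{N}\to\mathbb{R}_{\ge 0}$ with $\varepsilon(N)\to 0$ as $N\to\infty$ such that the following holds. Given an instance of the CSCP with graph $G=(V,E)$ on $n$ vertices, common sink $t$, edge capacities $c_e$ and commodities $S_1,\dots,S_k$, and given a feasible solution $d$ to the linear program MCP-LP for this instance, the algorithm produces a fractional laminar cut family $\mathcal{C}$ that is feasible for the CSCP on $G$ with edge capacities $c_e+\varepsilon(nk)$.
   Context: CSCP (common-sink $s$-$t$ cut packing): an undirected graph $G=(V,E)$ with positive integral edge capacities $c_e$, a sink $t\in V$, and $k$ commodities $S_1,\dots,S_k$, each consisting of exactly two terminals, one residing at $t$; terminal $i$ resides at vertex $r_i$, and the two terminals of a commodity reside at different vertices. MCP-LP: for each $a\in[k]$, a nonnegative symmetric function $d_a$ on $V\times V$ with $d_a(v,v)=0$ satisfying $d_a(u,v)\le d_a(u,w)+d_a(w,v)$ for all $u,v,w\in V$; $d_a(r_i,r_j)\ge 1$ for all $i\ne j$ in $S_a$; $\sum_a d_a(e)\le c_e$ for all $e\in E$; and $d_a(e)\in[0,1]$ for all $a\in[k]$, $e\in E$ (where $d_a(e)=d_a(u,v)$ for $e=(u,v)$). A cut is a set $C$ with $\emptyset\subsetneq C\subsetneq V$; $\delta(C)$ is the set of edges with exactly one endpoint in $C$. Two cuts $C_1,C_2$ cross if $C_1\cap C_2$, $C_1\setminus C_2$, $C_2\setminus C_1$ are all non-empty. A collection of cuts is laminar if no two of its members cross. A fractional laminar cut family $\mathcal{C}$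 for a terminal set $T$ with weight function $w\geq 0$ is a laminar collection of cuts, each cut being associated with a unique terminal of $T$ (the same vertex set may occur several times, for the same or different terminals), such that, writing $\mathcal{C}_i$ for the cuts associated with $i$, every $C\in\mathcal{C}_i$ contains $r_i$, and $\sum_{C\in\mathcal{C}_i}w(C)=1$ for every $i\in T$. Its load on $e$ is $\ell_e^{\mathcal{C}}=\sum_{C\in\mathcal{C}:\,e\in\delta(C)}w(C)$. The family is feasible for the CSCP with edge capacities $c'_e$ if (1) $T$ is the set of all terminals in $\bigcup_a S_a$ other than those at the sink $t$; (2) $t\notin\bigcup_{C\in\mathcal{C}}C$; (3) $\ell_e^{\mathcal{C}}\le c'_e$ for every $e\in E$. *)

theory Defs
  imports Complex_Main "HOL-Library.Log_Nat" "HOL-Computational_Algebra.Polynomial"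
begin

section \<open>Common-sink cut packing and its linear program\<close>

text \<open>
  Commodities are indexed by \<open>a < ncom I\<close>. Terminals are abstract objects of type \<open>'i\<close>;
  several of them may reside at the same vertex, and commodities may share terminals.
\<close>

record ('v, 'i) cscp =
  verts :: "'v set"
  edges :: "'v set set"
  cap :: "'v set \<Rightarrow> nat"
  sink :: 'v
  loc :: "'i \<Rightarrow> 'v"
  ncom :: nat
  com :: "nat \<Rightarrow> 'i set"

definition is_cscp :: "('v, 'i) cscp \<Rightarrow> bool" where
  "is_cscp I \<longleftrightarrow>
     finite (verts I) \<and>
     (\<forall>e\<in>edges I. e \<subseteq> verts I \<and> card e = 2) \<and>
     (\<forall>e\<in>edges I. cap I e > 0) \<and>
     sink I \<in> verts I \<and>
     (\<forall>a<ncom I. card (com I a) = 2 \<and>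
                 (\<forall>i\<in>com I a. loc I i \<in> verts I) \<and>
                 (\<exists>i\<in>com I a. loc I i = sink I) \<and>
                 inj_on (loc I) (com I a))"

definition mcp_lp_feasible :: "('v, 'i) cscp \<Rightarrow> (nat \<Rightarrow> 'v \<Rightarrow> 'v \<Rightarrow> real) \<Rightarrow> bool" where
  "mcp_lp_feasible I d \<longleftrightarrow>
     (\<forall>a<ncom I.
        (\<forall>u\<in>verts I. \<forall>v\<in>verts I. 0 \<le> d a u v \<and> d a u v = d a v u) \<and>
        (\<forall>v\<in>verts I. d a v v = 0) \<and>
        (\<forall>u\<in>verts I. \<forall>v\<in>verts I. \<forall>w\<in>verts I. d a u v \<le> d a u w + d a w v) \<and>
        (\<forall>i\<in>com I a. \<forall>j\<in>com I a. i \<noteq> j \<longrightarrow> 1 \<le> d a (loc I i) (loc I j)) \<and>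
        (\<forall>u v. {u, v} \<in> edges I \<longrightarrow> d a u v \<in> {0..1})) \<and>
     (\<forall>u v. {u, v} \<in> edges I \<longrightarrow> (\<Sum>a<ncom I. d a u v) \<le> real (cap I {u, v}))"

section \<open>Fractional laminar cut families\<close>

definition is_cut :: "'v set \<Rightarrow> 'v set \<Rightarrow> bool" where
  "is_cut V C \<longleftrightarrow> {} \<subset> C \<and> C \<subset> V"

definition cut_edges :: "'v set set \<Rightarrow> 'v set \<Rightarrow> 'v set set" where
  "cut_edges E C = {e \<in> E. card (e \<inter> C) = 1}"

definition cross :: "'v set \<Rightarrow> 'v set \<Rightarrow> bool" where
  "cross C D \<longleftrightarrow> C \<inter> D \<noteq> {} \<and> C - D \<noteq> {} \<and> D - C \<noteq> {}"

definition laminar :: "'v set set \<Rightarrow> bool" where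
  "laminar \<C> \<longleftrightarrow> (\<forall>C\<in>\<C>. \<forall>D\<in>\<C>. \<not> cross C D)"

text \<open>
  A family is a list of entries (vertex set, associated terminal, weight), so that the same
  vertex set can occur several times, for the same or for different terminals.
\<close>

type_synonym ('v, 'i) family = "('v set \<times> 'i \<times> real) list"

definition fractional_laminar_family ::
  "'v set \<Rightarrow> ('i \<Rightarrow> 'v) \<Rightarrow> 'i set \<Rightarrow> ('v, 'i) family \<Rightarrow> bool" where
  "fractional_laminar_family V r T F \<longleftrightarrow>
     (\<forall>(C, i, w)\<in>set F. is_cut V C \<and> i \<in> T \<and> r i \<in> C \<and> 0 \<le> w) \<and>
     laminar (fst ` set F) \<and>
     (\<forall>i\<in>T. (\<Sum>(C, j, w)\<leftarrow>F. if j = i then w else 0) = 1)"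

definition load :: "'v set set \<Rightarrow> ('v, 'i) family \<Rightarrow> 'v set \<Rightarrow> real" where
  "load E F e = (\<Sum>(C, i, w)\<leftarrow>F. if e \<in> cut_edges E C then w else 0)"

definition all_terminals :: "('v, 'i) cscp \<Rightarrow> 'i set" where
  "all_terminals I = (\<Union>a<ncom I. com I a)"

definition source_terminals :: "('v, 'i) cscp \<Rightarrow> 'i set" where
  "source_terminals I = {i \<in> all_terminals I. loc I i \<noteq> sink I}"

definition family_feasible ::
  "('v, 'i) cscp \<Rightarrow> ('v set \<Rightarrow> real) \<Rightarrow> ('v, 'i) family \<Rightarrow> bool" where
  "family_feasible I c' F \<longleftrightarrow>
     fractional_laminar_family (verts I) (loc I) (source_terminals I) F \<and>
     sink I \<notin> \<Union> (fst ` set F) \<and>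
     (\<forall>e\<in>edges I. load (edges I) F e \<le> c' e)"

section \<open>Algorithms and running time\<close>

text \<open>
  Algorithms are programs of a first-order functional language over binary trees with integer
  leaves. A program is a list of unary recursive functions, given by their bodies; function 0 is
  the main function. Evaluating an expression node costs the size of its value, where an integer
  counts with its binary length. Operands are themselves values of evaluated expressions and
  hence are charged as well, so this cost is polynomially related to Turing machine time.
\<close>

datatype data = Atom int | Node data data

fun dsize :: "data \<Rightarrow> nat" where
  "dsize (Atom z) = 1 + floorlog 2 (nat \<bar>z\<bar>)"
| "dsize (Node x y) = 1 + dsize x + dsize y"

datatype unop = Left | Right | IsNode
datatype binop = Pairing | Add | Sub | Mul | Div | Less

datatype expr =
    Arg
  | Const int
  | Op1 unop expr
  | Op2 binop expr expr
  | If expr expr expr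
  | Call nat expr

type_synonym program = "expr list"

fun num :: "data \<Rightarrow> int" where
  "num (Atom z) = z"
| "num (Node x y) = 0"

fun unop_val :: "unop \<Rightarrow> data \<Rightarrow> data" where
  "unop_val Left (Node x y) = x"
| "unop_val Left (Atom z) = Atom 0"
| "unop_val Right (Node x y) = y"
| "unop_val Right (Atom z) = Atom 0"
| "unop_val IsNode (Node x y) = Atom 1"
| "unop_val IsNode (Atom z) = Atom 0"

fun binop_val :: "binop \<Rightarrow> data \<Rightarrow> data \<Rightarrow> data" where
  "binop_val Pairing x y = Node x y"
| "binop_val Add x y = Atom (num x + num y)"
| "binop_val Sub x y = Atom (num x - num y)"
| "binop_val Mul x y = Atom (num x * num y)"
| "binop_val Div x y = Atom (num x div num y)"
| "binop_val Less x y = Atom (if num x < num y then 1 else 0)"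

text \<open>
  \<open>eval P x e v s\<close>: in a function of \<open>P\<close> called with argument \<open>x\<close>, the expression \<open>e\<close> evaluates
  to \<open>v\<close> at cost \<open>s\<close>. In a conditional, \<open>Atom 0\<close> is false and everything else is true.
\<close>

inductive eval :: "program \<Rightarrow> data \<Rightarrow> expr \<Rightarrow> data \<Rightarrow> nat \<Rightarrow> bool" for P where
  Arg: "eval P x Arg x (dsize x)"
| Const: "eval P x (Const z) (Atom z) (dsize (Atom z))"
| Op1: "eval P x e v s \<Longrightarrow> v' = unop_val f v \<Longrightarrow> eval P x (Op1 f e) v' (s + dsize v')"
| Op2: "eval P x e1 v1 s1 \<Longrightarrow> eval P x e2 v2 s2 \<Longrightarrow> v = binop_val f v1 v2 \<Longrightarrow>
    eval P x (Op2 f e1 e2) v (s1 + s2 + dsize v)"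
| IfTrue: "eval P x b u s0 \<Longrightarrow> u \<noteq> Atom 0 \<Longrightarrow> eval P x e1 v s1 \<Longrightarrow>
    eval P x (If b e1 e2) v (s0 + s1 + dsize v)"
| IfFalse: "eval P x b (Atom 0) s0 \<Longrightarrow> eval P x e2 v s2 \<Longrightarrow>
    eval P x (If b e1 e2) v (s0 + s2 + dsize v)"
| Call: "eval P x e u s0 \<Longrightarrow> f < length P \<Longrightarrow> eval P u (P ! f) v s1 \<Longrightarrow>
    eval P x (Call f e) v (s0 + s1 + dsize v)"

definition runs :: "program \<Rightarrow> data \<Rightarrow> data \<Rightarrow> nat \<Rightarrow> bool" where
  "runs P x y s \<longleftrightarrow> P \<noteq> [] \<and> eval P x (P ! 0) y s"

inductive_cases eval_elims:
  "eval P x Arg v s" "eval P x (Const z) v s" "eval P x (Op1 f e) v s" "eval P x (Op2 f e1 e2) v s"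
  "eval P x (If b e1 e2) v s" "eval P x (Call f e) v s"

lemma eval_det: "eval P x e v s \<Longrightarrow> eval P x e v' s' \<Longrightarrow> v' = v \<and> s' = s"
proof (induction arbitrary: v' s' rule: eval.induct)
  case (Const x z)
  then show ?case by (auto elim: eval_elims)
next
  case (Op1 x e v s w f)
  from Op1.prems show ?case by (rule eval_elims) (use Op1.IH Op1.hyps in blast)
next
  case (Op2 x e1 v1 s1 e2 v2 s2 v f)
  from Op2.prems show ?case by (rule eval_elims) (use Op2.IH Op2.hyps in blast)
next
  case (IfTrue x b u s0 e1 v s1 e2)
  from IfTrue.prems show ?case by (rule eval_elims) (use IfTrue.IH IfTrue.hyps in blast)+
next
  case (IfFalse x b s0 e2 v s2 e1)
  from IfFalse.prems show ?case by (rule eval_elims) (use IfFalse.IH in blast)+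
next
  case (Call x e u s0 f v s1)
  from Call.prems show ?case by (rule eval_elims) (use Call.IH in blast)
qed (auto elim: eval_elims)

lemma runs_det: "runs P x y s \<Longrightarrow> runs P x y' s' \<Longrightarrow> y' = y \<and> s' = s"
  unfolding runs_def using eval_det by blast

text \<open>Polynomial time on a set \<open>D\<close> of legal inputs:\<close>

definition poly_time_on :: "program \<Rightarrow> data set \<Rightarrow> bool" where
  "poly_time_on P D \<longleftrightarrow>
     (\<exists>p :: nat poly. \<forall>x\<in>D. \<exists>y s. runs P x y s \<and> s \<le> poly p (dsize x))"

section \<open>Encodings\<close>

text \<open>
  For the purpose of computation, vertices and terminals are natural numbers and the LP solution
  is rational; all numbers are written in binary.
\<close>

fun enc_list :: "data list \<Rightarrow> data" where
  "enc_list [] = Atom 0"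
| "enc_list (x # xs) = Node x (enc_list xs)"

definition enc_nat :: "nat \<Rightarrow> data" where
  "enc_nat n = Atom (int n)"

definition enc_rat :: "rat \<Rightarrow> data" where
  "enc_rat q = (case quotient_of q of (a, b) \<Rightarrow> Node (Atom a) (Atom b))"

definition enc_set :: "nat set \<Rightarrow> data" where
  "enc_set A = enc_list (map enc_nat (sorted_list_of_set A))"

definition enc_input :: "(nat, nat) cscp \<Rightarrow> (nat \<Rightarrow> nat \<Rightarrow> nat \<Rightarrow> rat) \<Rightarrow> data" where
  "enc_input I d =
    (let vs = sorted_list_of_set (verts I) in
     enc_list
      [enc_set (verts I),
       enc_list [Node (enc_nat u) (Node (enc_nat v) (enc_nat (cap I {u, v}))).
                 u \<leftarrow> vs, v \<leftarrow> vs, u < v \<and> {u, v} \<in> edges I],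
       enc_nat (sink I),
       enc_list [Node (enc_nat i) (enc_nat (loc I i)).
                 i \<leftarrow> sorted_list_of_set (all_terminals I)],
       enc_list [enc_set (com I a). a \<leftarrow> [0..<ncom I]],
       enc_list [enc_list [Node (enc_nat u) (Node (enc_nat v) (enc_rat (d a u v))).
                           u \<leftarrow> vs, v \<leftarrow> vs].
                 a \<leftarrow> [0..<ncom I]]])"

text \<open>
  In an output, vertex sets may be listed in any order and with repetitions, and weights may be
  given as unreduced fractions.
\<close>

definition represents_entry :: "data \<Rightarrow> nat set \<times> nat \<times> real \<Rightarrow> bool" where
  "represents_entry x = (\<lambda>(C, i, w). \<exists>vs p q. q > 0 \<and>
     x = Node (enc_list (map enc_nat vs)) (Node (enc_nat i) (Node (Atom p) (Atom q))) \<and>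
     C = set vs \<and> w = of_int p / of_int q)"

definition represents_family :: "data \<Rightarrow> (nat, nat) family \<Rightarrow> bool" where
  "represents_family y F \<longleftrightarrow> (\<exists>xs. y = enc_list xs \<and> list_all2 represents_entry xs F)"

end

theory Submission
  imports Defs "HOL-Library.Multiset"
begin

text \<open>
  Each commodity has one terminal away from the sink; for every such terminal \<open>i\<close> pick one
  commodity \<open>a\<close> containing it. Different terminals get different commodities. With
  \<open>N = n k\<^sup>2\<close>, give \<open>i\<close> the balls \<open>{v. d\<^sub>a(r\<^sub>i, v) \<le> m / N}\<close>, \<open>m < N\<close>, with weight \<open>1 / N\<close>
  each. By the triangle inequality their load on an edge \<open>e\<close> is at most \<open>d\<^sub>a(e) + 1 / N\<close>, which sums
  to at most \<open>c\<^sub>e + 1 / (n k)\<close>.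

  Two crossing cuts \<open>C\<close> of \<open>i\<close> and \<open>D\<close> of \<open>j\<close> are replaced by intersection and union if one of the
  terminals lies in both cuts, and by the two differences otherwise. Each terminal keeps a cut
  around it, no cut gains the sink, no load increases, and the sum of \<open>|C| (n - |C|)\<close> decreases.
  Hence polynomially many passes over all pairs make the family laminar.

  The program is obtained from closure properties of the class of polynomial-time functions.
\<close>

section \<open>A calculus of polynomial-time functions\<close>

text \<open>Giving every cut the same weight \<open>1 / N\<close> is what makes uncrossing simple:
  two crossing cuts are exchanged whole, no weight is ever split, and both the number of cuts and
  the number of cuts per terminal stay fixed. The price is rounding. Along an edge, the grid of
  radii may meet one point more than the length of the edge accounts for, an excess of
  \<open>1 / N\<close> per terminal. At most \<open>k\<close> terminals contribute, so the excess on
  an edge is \<open>k / N\<close>, and \<open>N = n k\<^sup>2\<close> turns this into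
  \<open>1 / (n k)\<close>. This \<open>N\<close> is polynomial, so all balls can be listed
  explicitly.

  The obstacle on the computational side is that iterating a polynomial-time function need not be
  polynomial, since intermediate values may explode. Each loop therefore comes with an invariant
  bounding the size of every state reached. For uncrossing it is the invariant of the correctness
  proof: cuts are duplicate-free lists of vertices other than the sink, and the multiset of
  terminals does not change.

  The sink lies outside all cuts. This makes the potential drop strictly even when two cuts are
  replaced by their differences.\<close>

fun shift :: "nat \<Rightarrow> expr \<Rightarrow> expr" where
  "shift k Arg = Arg"
| "shift k (Const z) = Const z"
| "shift k (Op1 f e) = Op1 f (shift k e)"
| "shift k (Op2 f e1 e2) = Op2 f (shift k e1) (shift k e2)"
| "shift k (If b e1 e2) = If (shift k b) (shift k e1) (shift k e2)"
| "shift k (Call f e) = Call (k + f) (shift k e)"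

definition embeds :: "program \<Rightarrow> program \<Rightarrow> nat \<Rightarrow> bool" where
  "embeds P Q k \<longleftrightarrow> (\<forall>j<length P. k + j < length Q \<and> Q ! (k + j) = shift k (P ! j))"

text \<open>Relocation changes nothing but the numbers of the callees, and these lead to the
  relocated bodies again. So programs can be concatenated without affecting values or costs.\<close>

lemma eval_shift:
  assumes "eval P x e v s" "embeds P Q k"
  shows "eval Q x (shift k e) v s"
  using assms
proof (induction rule: eval.induct)
  case (Call x e u s0 f v s1)
  then show ?case
    by (auto simp: embeds_def intro!: eval.Call)
qed (auto intro: eval.intros simp del: dsize.simps)

lemma embeds_append: "embeds P (A @ map (shift (length A)) P @ B) (length A)"
  by (auto simp: embeds_def nth_append)

lemma eval_Call_embedded:
  assumes "runs P x v s" "embeds P Q k" "eval Q y e x s0"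
  shows "eval Q y (Call k e) v (s0 + s + dsize v)"
proof -
  have "k < length Q" "Q ! k = shift k (P ! 0)"
    using assms by (auto simp: runs_def embeds_def dest: spec[of _ 0])
  with assms eval_shift[of P x "P ! 0" v s Q k] show ?thesis
    by (intro eval.Call) (auto simp: runs_def)
qed

text \<open>Every evaluation rule charges the size of its value. Hence a bound on the cost is also a
  bound on the output.\<close>

lemma dsize_le_cost: "eval P x e v s \<Longrightarrow> dsize v \<le> s"
  by (induction rule: eval.induct) auto

lemma poly_nat_mono: "m \<le> n \<Longrightarrow> poly p m \<le> poly p n" for p :: "nat poly"
  by (induction p) (auto intro: add_mono mult_mono)

section \<open>Bounds that are polynomial in the size of the encoded environment\<close>

definition poly_bounded :: "('x \<Rightarrow> data) \<Rightarrow> 'x set \<Rightarrow> ('x \<Rightarrow> nat) \<Rightarrow> bool" where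
  "poly_bounded e D f \<longleftrightarrow> (\<exists>p. \<forall>x\<in>D. f x \<le> poly p (dsize (e x)))"

lemma poly_bounded_mono:
  "poly_bounded e D g \<Longrightarrow> (\<And>x. x \<in> D \<Longrightarrow> f x \<le> g x) \<Longrightarrow> poly_bounded e D f"
  unfolding poly_bounded_def by (meson le_trans)

text \<open>A bound known only on \<open>D\<close> may be meaningless elsewhere, but the polynomial
  behind it makes sense everywhere. This serves conditionals, whose branches are analysed on parts
  of the domain.\<close>

lemma poly_bounded_extend:
  assumes "poly_bounded e D f"
  obtains g where "poly_bounded e D' g" "\<And>x. x \<in> D \<Longrightarrow> f x \<le> g x"
proof -
  obtain p where "\<forall>x\<in>D. f x \<le> poly p (dsize (e x))"
    using assms unfolding poly_bounded_def by blast
  then show ?thesis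
    by (intro that[of "\<lambda>x. poly p (dsize (e x))"]) (auto simp: poly_bounded_def)
qed

lemma poly_bounded_const: "poly_bounded e D (\<lambda>_. c)"
  unfolding poly_bounded_def by (rule exI[of _ "[:c:]"]) auto

lemma poly_bounded_dsize: "poly_bounded e D (\<lambda>x. dsize (e x))"
  unfolding poly_bounded_def by (rule exI[of _ "[:0, 1:]"]) auto

lemma poly_bounded_add:
  assumes "poly_bounded e D f" "poly_bounded e D g"
  shows "poly_bounded e D (\<lambda>x. f x + g x)"
proof -
  obtain p q where "\<forall>x\<in>D. f x \<le> poly p (dsize (e x))" "\<forall>x\<in>D. g x \<le> poly q (dsize (e x))"
    using assms unfolding poly_bounded_def by blast
  then show ?thesis
    unfolding poly_bounded_def by (intro exI[of _ "p + q"]) (auto intro: add_mono)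
qed

lemma poly_bounded_mult:
  assumes "poly_bounded e D f" "poly_bounded e D g"
  shows "poly_bounded e D (\<lambda>x. f x * g x)"
proof -
  obtain p q where "\<forall>x\<in>D. f x \<le> poly p (dsize (e x))" "\<forall>x\<in>D. g x \<le> poly q (dsize (e x))"
    using assms unfolding poly_bounded_def by blast
  then show ?thesis
    unfolding poly_bounded_def by (intro exI[of _ "p * q"]) (auto intro: mult_mono)
qed

lemma poly_bounded_poly:
  assumes "poly_bounded e D f"
  shows "poly_bounded e D (\<lambda>x. poly p (f x))"
proof -
  obtain q where q: "\<forall>x\<in>D. f x \<le> poly q (dsize (e x))"
    using assms unfolding poly_bounded_def by blast
  then show ?thesis
    unfolding poly_bounded_def
    by (intro exI[of _ "pcompose p q"]) (auto simp: poly_pcompose intro: poly_nat_mono)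
qed

lemma poly_bounded_compose:
  assumes "poly_bounded e' D' f" "poly_bounded e D (\<lambda>x. dsize (e' (\<phi> x)))" "\<And>x. x \<in> D \<Longrightarrow> \<phi> x \<in> D'"
  shows "poly_bounded e D (\<lambda>x. f (\<phi> x))"
proof -
  obtain p where p: "\<forall>x\<in>D'. f x \<le> poly p (dsize (e' x))"
    using assms(1) unfolding poly_bounded_def by blast
  show ?thesis
    by (rule poly_bounded_mono[OF poly_bounded_poly[OF assms(2), of p]]) (use p assms(3) in auto)
qed

lemmas poly_bounded_intros =
  poly_bounded_add poly_bounded_mult poly_bounded_const poly_bounded_dsize

text \<open>
  An \<open>x\<close> of arbitrary type plays the role of an environment that the program sees
  through the encoding \<open>e\<close>.
\<close>

definition polytime :: "('x \<Rightarrow> data) \<Rightarrow> 'x set \<Rightarrow> ('x \<Rightarrow> data) \<Rightarrow> bool" where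
  "polytime e D h \<longleftrightarrow>
     (\<exists>P c. poly_bounded e D c \<and> (\<forall>x\<in>D. \<exists>s\<le>c x. runs P (e x) (h x) s))"

lemma polytimeE:
  assumes "polytime e D h"
  obtains P c s where "poly_bounded e D c" "\<And>x. x \<in> D \<Longrightarrow> s x \<le> c x"
    "\<And>x. x \<in> D \<Longrightarrow> runs P (e x) (h x) (s x)" "\<And>x. x \<in> D \<Longrightarrow> dsize (h x) \<le> s x"
proof -
  obtain P c where c: "poly_bounded e D c" and "\<forall>x\<in>D. \<exists>s\<le>c x. runs P (e x) (h x) s"
    using assms unfolding polytime_def by blast
  then obtain s where s: "\<forall>x\<in>D. s x \<le> c x \<and> runs P (e x) (h x) (s x)"
    by metis
  show ?thesis
    by (rule that[of c s P]) (use s c in \<open>auto simp: runs_def dest: dsize_le_cost\<close>)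
qed

lemma polytimeI:
  assumes "poly_bounded e D c" "P \<noteq> []"
    "\<And>x. x \<in> D \<Longrightarrow> \<exists>s\<le>c x. eval P (e x) (P ! 0) (h x) s"
  shows "polytime e D h"
  using assms unfolding polytime_def runs_def by blast

lemma polytime_imp_poly_bounded:
  assumes "polytime e D h"
  shows "poly_bounded e D (\<lambda>x. dsize (h x))"
  using assms by (rule polytimeE) (meson le_trans poly_bounded_mono)

lemma polytime_subset: "polytime e D h \<Longrightarrow> D' \<subseteq> D \<Longrightarrow> polytime e D' h"
  unfolding polytime_def poly_bounded_def by blast

lemma polytime_cong:
  "polytime e D g \<Longrightarrow> (\<And>x. x \<in> D \<Longrightarrow> h x = g x) \<Longrightarrow> polytime e D h"
  unfolding polytime_def by auto

lemma polytime_env: "polytime e D e"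
  by (rule polytimeI[where P = "[Arg]" and c = "\<lambda>x. dsize (e x)"])
     (auto intro: poly_bounded_intros eval.intros)

lemma polytime_Atom: "polytime e D (\<lambda>_. Atom z)"
  by (rule polytimeI[where P = "[Const z]" and c = "\<lambda>x. dsize (Atom z)"])
     (auto intro: poly_bounded_intros eval.intros simp del: dsize.simps)

section \<open>Size growth of the primitive operations\<close>

lemma dsize_unop: "dsize (unop_val f x) \<le> 2 + dsize x"
  by (cases "(f, x)" rule: unop_val.cases) (auto simp: compute_floorlog)

lemma floorlog_mult_le: "floorlog 2 (a * b) \<le> floorlog 2 a + floorlog 2 b"
proof (cases "a = 0 \<or> b = 0")
  case False
  then have "a < 2 ^ floorlog 2 a" "b < 2 ^ floorlog 2 b"
    using floorlog_bounds[of a 2] floorlog_bounds[of b 2] by auto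
  then have "a * b < 2 ^ (floorlog 2 a + floorlog 2 b)"
    by (auto simp: power_add intro: mult_strict_mono')
  then show ?thesis
    by (intro floorlog_leI) auto
qed (auto simp: floorlog_def)

lemma floorlog_add_le: "floorlog 2 (a + b) \<le> floorlog 2 a + floorlog 2 b + 1"
proof -
  have less: "x < 2 ^ floorlog 2 x" for x
    using floorlog_bounds[of x 2] by (cases "x = 0") (auto simp: floorlog_def)
  have "2 ^ floorlog 2 a \<le> (2::nat) ^ (floorlog 2 a + floorlog 2 b)"
       "2 ^ floorlog 2 b \<le> (2::nat) ^ (floorlog 2 a + floorlog 2 b)"
    by (auto intro: power_increasing)
  with less[of a] less[of b] have "a + b < 2 ^ (floorlog 2 a + floorlog 2 b + 1)"
    unfolding power_add power_one_right by linarith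
  then show ?thesis
    by (intro floorlog_leI) auto
qed

lemma dsize_num: "1 + floorlog 2 (nat \<bar>num x\<bar>) \<le> dsize x"
  by (cases x) (auto simp: floorlog_def)

text \<open>One estimate for \<open>Add\<close>, \<open>Sub\<close>, \<open>Div\<close> and
  \<open>Less\<close> together; the summand 1 leaves room for a truth value and for the bound on
  quotients.\<close>

lemma dsize_Atom_add_le:
  assumes "\<bar>z\<bar> \<le> \<bar>num x\<bar> + \<bar>num y\<bar> + 1"
  shows "dsize (Atom z) \<le> 4 + dsize x + dsize y"
proof -
  have one: "floorlog 2 1 = 1"
    by (simp add: compute_floorlog)
  have "nat \<bar>z\<bar> \<le> nat \<bar>num x\<bar> + nat \<bar>num y\<bar> + 1"
    using assms by linarith
  then have "floorlog 2 (nat \<bar>z\<bar>) \<le> floorlog 2 (nat \<bar>num x\<bar> + nat \<bar>num y\<bar> + 1)"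
    by (rule floorlog_mono)
  also have "\<dots> \<le> floorlog 2 (nat \<bar>num x\<bar>) + floorlog 2 (nat \<bar>num y\<bar>) + 3"
    using floorlog_add_le[of "nat \<bar>num x\<bar> + nat \<bar>num y\<bar>" 1]
      floorlog_add_le[of "nat \<bar>num x\<bar>" "nat \<bar>num y\<bar>"] one by simp
  finally show ?thesis
    using dsize_num[of x] dsize_num[of y] by simp
qed

lemma abs_div_le: "\<bar>a div b\<bar> \<le> \<bar>a\<bar> + 1" for a b :: int
proof (cases "b = 0")
  case False
  have "\<bar>a div b\<bar> * \<bar>b\<bar> = \<bar>a - a mod b\<bar>"
    by (metis abs_mult minus_mod_eq_div_mult)
  also have "\<dots> \<le> \<bar>a\<bar> + \<bar>b\<bar>"
    using abs_mod_less[OF False, of a] by linarith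
  finally have "\<bar>a div b\<bar> * \<bar>b\<bar> \<le> \<bar>a\<bar> * \<bar>b\<bar> + \<bar>b\<bar>"
    using False mult_left_mono[of 1 "\<bar>b\<bar>" "\<bar>a\<bar>"] by linarith
  then have "\<bar>a div b\<bar> * \<bar>b\<bar> \<le> (\<bar>a\<bar> + 1) * \<bar>b\<bar>"
    by (simp add: algebra_simps)
  then show ?thesis
    using False by (simp add: mult_le_cancel_right)
qed auto

lemma dsize_binop: "dsize (binop_val f x y) \<le> 4 + dsize x + dsize y"
proof (cases f)
  case Mul
  then show ?thesis
    using floorlog_mult_le[of "nat \<bar>num x\<bar>" "nat \<bar>num y\<bar>"] dsize_num[of x] dsize_num[of y]
    by (simp add: abs_mult nat_mult_distrib)
next
  case Div
  then show ?thesis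
    using dsize_Atom_add_le[of "num x div num y" x y] abs_div_le[of "num x" "num y"] by simp
next
  case Less
  then show ?thesis
    using dsize_Atom_add_le[of "if num x < num y then 1 else 0" x y] by simp
next
  case Add
  then show ?thesis
    using dsize_Atom_add_le[of "num x + num y" x y] by simp
next
  case Sub
  then show ?thesis
    using dsize_Atom_add_le[of "num x - num y" x y] by simp
qed auto

section \<open>Closure under primitive operations, conditionals and composition\<close>

lemma polytime_unop:
  assumes "polytime e D g"
  shows "polytime e D (\<lambda>x. unop_val f (g x))"
  using assms
proof (rule polytimeE)
  fix P c s
  assume *: "poly_bounded e D c" "\<And>x. x \<in> D \<Longrightarrow> s x \<le> c x"
    "\<And>x. x \<in> D \<Longrightarrow> runs P (e x) (g x) (s x)" "\<And>x. x \<in> D \<Longrightarrow> dsize (g x) \<le> s x"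
  \<comment> \<open>The pattern of the closure lemmas that follow: a new main function, followed by
    the relocated programs of the parts, which it calls at their offsets.\<close>
  define Q where "Q = [Op1 f (Call 1 Arg)] @ map (shift 1) P @ []"
  have emb: "embeds P Q 1"
    unfolding Q_def using embeds_append[of P "[Op1 f (Call 1 Arg)]" "[]"] by simp
  show ?thesis
  proof (rule polytimeI[of e D "\<lambda>x. dsize (e x) + c x + c x + (2 + c x)" Q])
    show "poly_bounded e D (\<lambda>x. dsize (e x) + c x + c x + (2 + c x))"
      using * by (intro poly_bounded_intros)
    fix x assume x: "x \<in> D"
    have "eval Q (e x) (Op1 f (Call 1 Arg)) (unop_val f (g x))
        (dsize (e x) + s x + dsize (g x) + dsize (unop_val f (g x)))"
      by (rule eval.Op1[OF eval_Call_embedded[OF *(3)[OF x] emb eval.Arg] refl])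
    moreover have "dsize (e x) + s x + dsize (g x) + dsize (unop_val f (g x))
        \<le> dsize (e x) + c x + c x + (2 + c x)"
      using *(2,4)[OF x] dsize_unop[of f "g x"] by linarith
    ultimately show "\<exists>s\<le>dsize (e x) + c x + c x + (2 + c x). eval Q (e x) (Q ! 0) (unop_val f (g x)) s"
      unfolding Q_def append_Cons nth_Cons_0 by blast
  qed (auto simp: Q_def)
qed

lemma polytime_binop:
  assumes "polytime e D g" "polytime e D h"
  shows "polytime e D (\<lambda>x. binop_val f (g x) (h x))"
proof -
  obtain P c s where *: "poly_bounded e D c" "\<And>x. x \<in> D \<Longrightarrow> s x \<le> c x"
    "\<And>x. x \<in> D \<Longrightarrow> runs P (e x) (g x) (s x)" "\<And>x. x \<in> D \<Longrightarrow> dsize (g x) \<le> s x"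
    using assms(1) by (rule polytimeE) blast
  obtain P' c' s' where **: "poly_bounded e D c'" "\<And>x. x \<in> D \<Longrightarrow> s' x \<le> c' x"
    "\<And>x. x \<in> D \<Longrightarrow> runs P' (e x) (h x) (s' x)" "\<And>x. x \<in> D \<Longrightarrow> dsize (h x) \<le> s' x"
    using assms(2) by (rule polytimeE) blast
  define k where "k = 1 + length P"
  define b where "b = Op2 f (Call 1 Arg) (Call k Arg)"
  define Q where "Q = b # map (shift 1) P @ map (shift k) P'"
  have emb: "embeds P Q 1" "embeds P' Q k"
    using embeds_append[of P "[b]" "map (shift k) P'"]
      embeds_append[of P' "b # map (shift 1) P" "[]"]
    by (auto simp: Q_def k_def)
  let ?c = "\<lambda>x. dsize (e x) + c x + c x + (dsize (e x) + c' x + c' x) + (4 + c x + c' x)"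
  show ?thesis
  proof (rule polytimeI[of e D ?c Q])
    show "poly_bounded e D ?c"
      using * ** by (intro poly_bounded_intros)
    fix x assume x: "x \<in> D"
    let ?v = "binop_val f (g x) (h x)"
    have "eval Q (e x) b ?v (dsize (e x) + s x + dsize (g x) +
        (dsize (e x) + s' x + dsize (h x)) + dsize ?v)"
      unfolding b_def
      by (rule eval.Op2[OF eval_Call_embedded[OF *(3)[OF x] emb(1) eval.Arg]
          eval_Call_embedded[OF **(3)[OF x] emb(2) eval.Arg] refl])
    moreover have "dsize (e x) + s x + dsize (g x) +
        (dsize (e x) + s' x + dsize (h x)) + dsize ?v \<le> ?c x"
      using *(2,4)[OF x] **(2,4)[OF x] dsize_binop[of f "g x" "h x"] by linarith
    ultimately show "\<exists>s\<le>?c x. eval Q (e x) (Q ! 0) ?v s"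
      unfolding Q_def append_Cons nth_Cons_0 by blast
  qed (auto simp: Q_def)
qed

definition enc_bool :: "bool \<Rightarrow> data" where
  "enc_bool b = Atom (if b then 1 else 0)"

text \<open>A conditional charges only the branch taken, so each branch has to be efficient only on
  the inputs that reach it.\<close>

lemma polytime_if:
  assumes "polytime e D (\<lambda>x. enc_bool (b x))"
    "polytime e {x \<in> D. b x} g" "polytime e {x \<in> D. \<not> b x} h"
  shows "polytime e D (\<lambda>x. if b x then g x else h x)"
proof -
  obtain P c s where *: "poly_bounded e D c" "\<And>x. x \<in> D \<Longrightarrow> s x \<le> c x"
    "\<And>x. x \<in> D \<Longrightarrow> runs P (e x) (enc_bool (b x)) (s x)" "\<And>x. x \<in> D \<Longrightarrow> dsize (enc_bool (b x)) \<le> s x"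
    using assms(1) by (rule polytimeE) blast
  obtain P' c' s' where **: "poly_bounded e {x \<in> D. b x} c'" "\<And>x. x \<in> D \<Longrightarrow> b x \<Longrightarrow> s' x \<le> c' x"
    "\<And>x. x \<in> D \<Longrightarrow> b x \<Longrightarrow> runs P' (e x) (g x) (s' x)" "\<And>x. x \<in> D \<Longrightarrow> b x \<Longrightarrow> dsize (g x) \<le> s' x"
    using assms(2) by (rule polytimeE) blast
  obtain P'' c'' s'' where ***: "poly_bounded e {x \<in> D. \<not> b x} c''"
    "\<And>x. x \<in> D \<Longrightarrow> \<not> b x \<Longrightarrow> s'' x \<le> c'' x"
    "\<And>x. x \<in> D \<Longrightarrow> \<not> b x \<Longrightarrow> runs P'' (e x) (h x) (s'' x)"
    "\<And>x. x \<in> D \<Longrightarrow> \<not> b x \<Longrightarrow> dsize (h x) \<le> s'' x"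
    using assms(3) by (rule polytimeE) blast
  define k where "k = 1 + length P"
  define l where "l = k + length P'"
  define t where "t = If (Call 1 Arg) (Call k Arg) (Call l Arg)"
  define Q where "Q = t # map (shift 1) P @ map (shift k) P' @ map (shift l) P''"
  have emb: "embeds P Q 1" "embeds P' Q k" "embeds P'' Q l"
    using embeds_append[of P "[t]" "map (shift k) P' @ map (shift l) P''"]
      embeds_append[of P' "t # map (shift 1) P" "map (shift l) P''"]
      embeds_append[of P'' "t # map (shift 1) P @ map (shift k) P'" "[]"]
    by (auto simp: Q_def k_def l_def)
  \<comment> \<open>The branch budgets are bounded only on their own parts of \<open>D\<close>; the
    total budget needs functions bounded on all of \<open>D\<close>.\<close>
  obtain q' where q': "poly_bounded e D q'" "\<And>x. x \<in> {x \<in> D. b x} \<Longrightarrow> c' x \<le> q' x"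
    using **(1) by (rule poly_bounded_extend) blast
  obtain q'' where q'': "poly_bounded e D q''" "\<And>x. x \<in> {x \<in> D. \<not> b x} \<Longrightarrow> c'' x \<le> q'' x"
    using ***(1) by (rule poly_bounded_extend) blast
  let ?c = "\<lambda>x. dsize (e x) + c x + c x + (dsize (e x) + 3 * (q' x + q'' x))"
  show ?thesis
  proof (rule polytimeI[of e D ?c Q])
    show "poly_bounded e D ?c"
      using * q'(1) q''(1) by (intro poly_bounded_intros)
    fix x assume x: "x \<in> D"
    show "\<exists>s\<le>?c x. eval Q (e x) (Q ! 0) (if b x then g x else h x) s"
    proof (cases "b x")
      case True
      have "eval Q (e x) t (g x) (dsize (e x) + s x + dsize (enc_bool (b x)) +
          (dsize (e x) + s' x + dsize (g x)) + dsize (g x))"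
        unfolding t_def using True
        by (intro eval.IfTrue[OF eval_Call_embedded[OF *(3)[OF x] emb(1) eval.Arg] _
            eval_Call_embedded[OF **(3)[OF x True] emb(2) eval.Arg]]) (simp add: enc_bool_def)
      moreover have "dsize (e x) + s x + dsize (enc_bool (b x)) +
          (dsize (e x) + s' x + dsize (g x)) + dsize (g x) \<le> ?c x"
        using *(2,4)[OF x] **(2,4)[OF x True] q'(2)[of x] x True by simp
      ultimately show ?thesis
        using True unfolding Q_def nth_Cons_0 if_P[OF True] by blast
    next
      case False
      then have "runs P (e x) (Atom 0) (s x)"
        using *(3)[OF x] by (simp add: enc_bool_def)
      then have "eval Q (e x) t (h x) (dsize (e x) + s x + dsize (Atom 0) +
          (dsize (e x) + s'' x + dsize (h x)) + dsize (h x))"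
        unfolding t_def
        by (rule eval.IfFalse[OF eval_Call_embedded[OF _ emb(1) eval.Arg]
            eval_Call_embedded[OF ***(3)[OF x False] emb(3) eval.Arg]])
      moreover have "dsize (Atom 0) \<le> s x"
        using *(4)[OF x] False by (simp add: enc_bool_def del: dsize.simps)
      then have "dsize (e x) + s x + dsize (Atom 0) +
          (dsize (e x) + s'' x + dsize (h x)) + dsize (h x) \<le> ?c x"
        using *(2,4)[OF x] ***(2,4)[OF x False] q''(2)[of x] x False by simp
      ultimately show ?thesis
        unfolding Q_def nth_Cons_0 if_not_P[OF False] by blast
    qed
  qed (auto simp: Q_def)
qed

text \<open>A change of environment: a program written for arguments seen through \<open>e'\<close>
  serves those seen through \<open>e\<close> once the encoding of \<open>\<phi> x\<close> is
  computable. That encoding has polynomial size, and polynomials compose.\<close>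

lemma polytime_compose:
  assumes "polytime e' D' h" "polytime e D (\<lambda>x. e' (\<phi> x))" "\<And>x. x \<in> D \<Longrightarrow> \<phi> x \<in> D'"
  shows "polytime e D (\<lambda>x. h (\<phi> x))"
proof -
  obtain P c s where *: "poly_bounded e' D' c" "\<And>x. x \<in> D' \<Longrightarrow> s x \<le> c x"
    "\<And>x. x \<in> D' \<Longrightarrow> runs P (e' x) (h x) (s x)" "\<And>x. x \<in> D' \<Longrightarrow> dsize (h x) \<le> s x"
    using assms(1) by (rule polytimeE) blast
  obtain P' c' s' where **: "poly_bounded e D c'" "\<And>x. x \<in> D \<Longrightarrow> s' x \<le> c' x"
    "\<And>x. x \<in> D \<Longrightarrow> runs P' (e x) (e' (\<phi> x)) (s' x)" "\<And>x. x \<in> D \<Longrightarrow> dsize (e' (\<phi> x)) \<le> s' x"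
    using assms(2) by (rule polytimeE) blast
  have bd: "poly_bounded e D (\<lambda>x. c (\<phi> x))"
    using *(1) polytime_imp_poly_bounded[OF assms(2)] assms(3) by (rule poly_bounded_compose)
  define k where "k = 1 + length P"
  define b where "b = Call 1 (Call k Arg)"
  define Q where "Q = b # map (shift 1) P @ map (shift k) P'"
  have emb: "embeds P Q 1" "embeds P' Q k"
    using embeds_append[of P "[b]" "map (shift k) P'"]
      embeds_append[of P' "b # map (shift 1) P" "[]"]
    by (auto simp: Q_def k_def)
  let ?c = "\<lambda>x. dsize (e x) + c' x + c' x + (c (\<phi> x) + c (\<phi> x))"
  show ?thesis
  proof (rule polytimeI[of e D ?c Q])
    show "poly_bounded e D ?c"
      using bd ** by (intro poly_bounded_intros)
    fix x assume x: "x \<in> D"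
    note x' = assms(3)[OF x]
    have "eval Q (e x) b (h (\<phi> x)) (dsize (e x) + s' x + dsize (e' (\<phi> x)) + s (\<phi> x) + dsize (h (\<phi> x)))"
      unfolding b_def
      by (rule eval_Call_embedded[OF *(3)[OF x'] emb(1)
          eval_Call_embedded[OF **(3)[OF x] emb(2) eval.Arg]])
    moreover have "dsize (e x) + s' x + dsize (e' (\<phi> x)) + s (\<phi> x) + dsize (h (\<phi> x)) \<le> ?c x"
      using *(2,4)[OF x'] **(2,4)[OF x] by linarith
    ultimately show "\<exists>s\<le>?c x. eval Q (e x) (Q ! 0) (h (\<phi> x)) s"
      unfolding Q_def nth_Cons_0 by blast
  qed (auto simp: Q_def)
qed

subsection \<open>Pairs, numbers and truth values\<close>

definition enc_pair :: "('a \<Rightarrow> data) \<Rightarrow> ('b \<Rightarrow> data) \<Rightarrow> 'a \<times> 'b \<Rightarrow> data" where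
  "enc_pair ea eb p = Node (ea (fst p)) (eb (snd p))"

lemma polytime_Node:
  "polytime e D g \<Longrightarrow> polytime e D h \<Longrightarrow> polytime e D (\<lambda>x. Node (g x) (h x))"
  using polytime_binop[of e D g h Pairing] by simp

lemma polytime_Pair:
  "polytime e D (\<lambda>x. ea (g x)) \<Longrightarrow> polytime e D (\<lambda>x. eb (h x)) \<Longrightarrow>
    polytime e D (\<lambda>x. enc_pair ea eb (g x, h x))"
  unfolding enc_pair_def fst_conv snd_conv by (rule polytime_Node)

lemma polytime_proj1:
  "polytime e D (\<lambda>x. enc_pair ea eb (p x)) \<Longrightarrow> polytime e D (\<lambda>x. ea (fst (p x)))"
  using polytime_unop[of e D "\<lambda>x. enc_pair ea eb (p x)" Left] by (simp add: enc_pair_def)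

lemma polytime_proj2:
  "polytime e D (\<lambda>x. enc_pair ea eb (p x)) \<Longrightarrow> polytime e D (\<lambda>x. eb (snd (p x)))"
  using polytime_unop[of e D "\<lambda>x. enc_pair ea eb (p x)" Right] by (simp add: enc_pair_def)

text \<open>Weakening. Environments are nested pairs; entering the body of a map or a fold adds a
  component, and what was computable outside remains so inside.\<close>

lemma polytime_fst:
  assumes "polytime e D h" "\<And>y. y \<in> D' \<Longrightarrow> fst y \<in> D"
  shows "polytime (enc_pair e ea) D' (\<lambda>y. h (fst y))"
proof (rule polytime_compose[where \<phi> = fst and D' = D, OF assms(1)])
  show "polytime (enc_pair e ea) D' (\<lambda>y. e (fst y))"
    by (rule polytime_proj1[OF polytime_env])
qed (rule assms(2))

lemma polytime_snd: "polytime (enc_pair e ea) D' (\<lambda>y. ea (snd y))"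
  by (rule polytime_proj2[OF polytime_env])

lemma polytime_if_total:
  assumes "polytime e D (\<lambda>x. enc_bool (b x))" "polytime e D g" "polytime e D h"
  shows "polytime e D (\<lambda>x. if b x then g x else h x)"
  using assms by (intro polytime_if) (auto intro: polytime_subset)

lemma polytime_True: "polytime e D (\<lambda>_. enc_bool True)"
  and polytime_False: "polytime e D (\<lambda>_. enc_bool False)"
  by (simp_all add: enc_bool_def polytime_Atom)

lemma polytime_not:
  assumes "polytime e D (\<lambda>x. enc_bool (b x))"
  shows "polytime e D (\<lambda>x. enc_bool (\<not> b x))"
  by (rule polytime_cong[OF polytime_if[OF assms polytime_False polytime_True]]) auto

lemma polytime_and:
  assumes "polytime e D (\<lambda>x. enc_bool (b x))" "polytime e D (\<lambda>x. enc_bool (c x))"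
  shows "polytime e D (\<lambda>x. enc_bool (b x \<and> c x))"
  by (rule polytime_cong[OF polytime_if[OF assms(1) polytime_subset[OF assms(2)] polytime_False]]) auto

lemma polytime_add_nat:
  "polytime e D (\<lambda>x. enc_nat (m x)) \<Longrightarrow> polytime e D (\<lambda>x. enc_nat (n x)) \<Longrightarrow>
    polytime e D (\<lambda>x. enc_nat (m x + n x))"
  using polytime_binop[of e D "\<lambda>x. enc_nat (m x)" "\<lambda>x. enc_nat (n x)" Add] by (simp add: enc_nat_def)

lemma polytime_mult_int:
  "polytime e D (\<lambda>x. Atom (m x)) \<Longrightarrow> polytime e D (\<lambda>x. Atom (n x)) \<Longrightarrow>
    polytime e D (\<lambda>x. Atom (m x * n x))"
  using polytime_binop[of e D "\<lambda>x. Atom (m x)" "\<lambda>x. Atom (n x)" Mul] by simp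

lemma polytime_less_int:
  "polytime e D (\<lambda>x. Atom (m x)) \<Longrightarrow> polytime e D (\<lambda>x. Atom (n x)) \<Longrightarrow>
    polytime e D (\<lambda>x. enc_bool (m x < n x))"
  using polytime_binop[of e D "\<lambda>x. Atom (m x)" "\<lambda>x. Atom (n x)" Less]
  by (simp add: enc_bool_def)

lemma polytime_eq_nat:
  assumes "polytime e D (\<lambda>x. enc_nat (m x))" "polytime e D (\<lambda>x. enc_nat (n x))"
  shows "polytime e D (\<lambda>x. enc_bool (m x = n x))"
proof -
  note a = assms[unfolded enc_nat_def]
  show ?thesis
    by (rule polytime_cong[OF polytime_and[OF polytime_not[OF polytime_less_int[OF a]]
          polytime_not[OF polytime_less_int[OF a(2,1)]]]]) (auto intro: arg_cong[where f = enc_bool])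
qed

subsection \<open>Bounded iteration over lists\<close>

lemma dsize_enc_list: "dsize (enc_list xs) = 1 + (\<Sum>x\<leftarrow>xs. 1 + dsize x)"
  by (induction xs) (auto simp: floorlog_def)

lemma length_le_dsize: "length xs \<le> dsize (enc_list xs)"
  by (induction xs) auto

lemma dsize_mem_le: "x \<in> set xs \<Longrightarrow> dsize x \<le> dsize (enc_list xs)"
  by (induction xs) auto

lemma dsize_enc_list_le:
  "(\<And>x. x \<in> set xs \<Longrightarrow> dsize x \<le> b) \<Longrightarrow> length xs \<le> n \<Longrightarrow> dsize (enc_list xs) \<le> 1 + n * (1 + b)"
proof (induction xs arbitrary: n)
  case (Cons x xs)
  then obtain m where n: "n = Suc m" "length xs \<le> m"
    by (cases n) auto
  have "dsize x \<le> b" "dsize (enc_list xs) \<le> 1 + m * (1 + b)"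
    using Cons n by auto
  then show ?case
    using n by simp
qed (auto simp: floorlog_def)

text \<open>On \<open>Node xs (Node c s)\<close>, folds the function with number 1 over the list \<open>xs\<close>.\<close>

definition fold_loop :: expr where
  "fold_loop =
    If (Op1 IsNode (Op1 Left Arg))
     (Call 0
       (Op2 Pairing (Op1 Right (Op1 Left Arg))
         (Op2 Pairing (Op1 Left (Op1 Right Arg))
           (Call 1 (Op2 Pairing (Op2 Pairing (Op1 Left (Op1 Right Arg)) (Op1 Left (Op1 Left Arg)))
                      (Op1 Right (Op1 Right Arg)))))))
     (Op1 Right (Op1 Right Arg))"

lemma eval_proj: "eval P x (Op1 f (Op1 g Arg)) (unop_val f (unop_val g x))
    (dsize x + dsize (unop_val g x) + dsize (unop_val f (unop_val g x)))"
  by (rule eval.Op1[OF eval.Op1[OF eval.Arg refl] refl])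

lemma eval_fold_loop_Nil:
  fixes c s
  defines "A \<equiv> Node (Atom 0) (Node c s)"
  shows "\<exists>k\<le>7 * dsize A. eval Q A fold_loop s k"
proof -
  have "eval Q A (Op1 IsNode (Op1 Left Arg)) (Atom 0) (dsize A + dsize (Atom 0) + dsize (Atom 0))"
    using eval_proj[of Q A IsNode Left] by (simp add: A_def)
  moreover have "eval Q A (Op1 Right (Op1 Right Arg)) s (dsize A + dsize (Node c s) + dsize s)"
    using eval_proj[of Q A Right Right] by (simp add: A_def)
  ultimately have "eval Q A fold_loop s (dsize A + dsize (Atom 0) + dsize (Atom 0) +
      (dsize A + dsize (Node c s) + dsize s) + dsize s)"
    unfolding fold_loop_def by (rule eval.IfFalse)
  moreover have "dsize A + dsize (Atom 0) + dsize (Atom 0) +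
      (dsize A + dsize (Node c s) + dsize s) + dsize s \<le> 7 * dsize A"
    by (simp add: A_def floorlog_def)
  ultimately show ?thesis
    by blast
qed

lemma eval_fold_loop_Cons:
  fixes h t c s s'
  defines "A \<equiv> Node (Node h t) (Node c s)" and "A' \<equiv> Node t (Node c s')"
  assumes Q: "Q \<noteq> []" "Q ! 0 = fold_loop" "embeds P Q 1"
    and step: "runs P (Node (Node c h) s) s' k1"
    and rec: "eval Q A' fold_loop v k2"
    and W: "dsize A \<le> W" "dsize A' \<le> W" "dsize v \<le> W"
  shows "\<exists>k\<le>24 * W + k1 + k2. eval Q A fold_loop v k"
proof -
  have cond: "eval Q A (Op1 IsNode (Op1 Left Arg)) (Atom 1) (dsize A + dsize (Node h t) + dsize (Atom 1))"
    using eval_proj[of Q A IsNode Left] by (simp add: A_def)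
  have t: "eval Q A (Op1 Right (Op1 Left Arg)) t (dsize A + dsize (Node h t) + dsize t)"
    using eval_proj[of Q A Right Left] by (simp add: A_def)
  have h: "eval Q A (Op1 Left (Op1 Left Arg)) h (dsize A + dsize (Node h t) + dsize h)"
    using eval_proj[of Q A Left Left] by (simp add: A_def)
  have c: "eval Q A (Op1 Left (Op1 Right Arg)) c (dsize A + dsize (Node c s) + dsize c)"
    using eval_proj[of Q A Left Right] by (simp add: A_def)
  have s: "eval Q A (Op1 Right (Op1 Right Arg)) s (dsize A + dsize (Node c s) + dsize s)"
    using eval_proj[of Q A Right Right] by (simp add: A_def)
  have chs: "eval Q A (Op2 Pairing (Op2 Pairing (Op1 Left (Op1 Right Arg)) (Op1 Left (Op1 Left Arg)))
      (Op1 Right (Op1 Right Arg))) (Node (Node c h) s)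
      ((dsize A + dsize (Node c s) + dsize c) + (dsize A + dsize (Node h t) + dsize h) +
       dsize (Node c h) + (dsize A + dsize (Node c s) + dsize s) + dsize (Node (Node c h) s))"
    (is "eval _ _ ?e _ ?k3")
    by (rule eval.Op2[OF eval.Op2[OF c h] s]) simp_all
  have s': "eval Q A (Call 1 ?e) s' (?k3 + k1 + dsize s')"
    by (rule eval_Call_embedded[OF step Q(3) chs])
  have A': "eval Q A (Op2 Pairing (Op1 Right (Op1 Left Arg)) (Op2 Pairing (Op1 Left (Op1 Right Arg))
      (Call 1 ?e))) A' ((dsize A + dsize (Node h t) + dsize t) +
       ((dsize A + dsize (Node c s) + dsize c) + (?k3 + k1 + dsize s') + dsize (Node c s')) + dsize A')"
    (is "eval _ _ ?e' _ ?k4")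
    unfolding A'_def by (rule eval.Op2[OF t eval.Op2[OF c s']]) simp_all
  have v: "eval Q A (Call 0 ?e') v (?k4 + k2 + dsize v)"
    by (rule eval.Call[OF A']) (use Q rec in auto)
  have "eval Q A fold_loop v (dsize A + dsize (Node h t) + dsize (Atom 1) + (?k4 + k2 + dsize v) + dsize v)"
    unfolding fold_loop_def by (rule eval.IfTrue[OF cond _ v]) simp
  \<comment> \<open>Each value charged in this round is no larger than \<open>A\<close>,
    \<open>A'\<close> or \<open>v\<close>, hence at most \<open>W\<close>.\<close>
  moreover have "dsize (Atom 1) \<le> dsize A"
    by (simp add: A_def compute_floorlog)
  then have "dsize A + dsize (Node h t) + dsize (Atom 1) + (?k4 + k2 + dsize v) + dsize v
      \<le> 24 * W + k1 + k2"
    using W by (simp add: A_def A'_def del: dsize.simps(1))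
  ultimately show ?thesis
    by blast
qed

text \<open>Induction on the unread suffix \<open>zs\<close>. The assumptions speak of splittings of
  \<open>l\<close>, so the step and the size bound are required only for accumulators that really
  occur.\<close>

lemma eval_fold_loop:
  assumes Q: "Q \<noteq> []" "Q ! 0 = fold_loop" "embeds P Q 1"
    and step: "\<And>ys a zs. l = ys @ a # zs \<Longrightarrow>
      \<exists>k\<le>C. runs P (Node (Node c (ea a)) (eb (fold f ys s))) (eb (fold f (ys @ [a]) s)) k"
    and W: "\<And>ys zs. l = ys @ zs \<Longrightarrow>
      dsize (Node (enc_list (map ea zs)) (Node c (eb (fold f ys s)))) \<le> W"
    and l: "l = ys @ zs"
  shows "\<exists>k\<le>7 * W + length zs * (24 * W + C).
    eval Q (Node (enc_list (map ea zs)) (Node c (eb (fold f ys s)))) fold_loop (eb (fold f l s)) k"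
  using l
proof (induction zs arbitrary: ys)
  case Nil
  define A where "A = Node (Atom 0) (Node c (eb (fold f l s)))"
  have "dsize A \<le> W"
    using W[of l "[]"] by (simp add: A_def)
  moreover obtain k where "k \<le> 7 * dsize A" "eval Q A fold_loop (eb (fold f l s)) k"
    using eval_fold_loop_Nil unfolding A_def by blast
  ultimately have "\<exists>k\<le>7 * W. eval Q A fold_loop (eb (fold f l s)) k"
    by (meson le_trans mult_le_mono2)
  with Nil show ?case
    by (simp add: A_def)
next
  case (Cons a zs)
  let ?B = "7 * W + length zs * (24 * W + C)"
  obtain k2 where k2: "k2 \<le> ?B"
    "eval Q (Node (enc_list (map ea zs)) (Node c (eb (fold f (ys @ [a]) s)))) fold_loop (eb (fold f l s)) k2"
    using Cons.IH[of "ys @ [a]"] Cons.prems by auto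
  obtain k1 where k1: "k1 \<le> C"
    "runs P (Node (Node c (ea a)) (eb (fold f ys s))) (eb (fold f (ys @ [a]) s)) k1"
    using step Cons.prems by blast
  have "dsize (eb (fold f l s)) \<le> W"
    using W[of l "[]"] by simp
  then obtain k where "k \<le> 24 * W + k1 + k2"
    "eval Q (Node (enc_list (map ea (a # zs))) (Node c (eb (fold f ys s)))) fold_loop (eb (fold f l s)) k"
    using eval_fold_loop_Cons[OF Q k1(2) k2(2), of W] W[of ys "a # zs"] W[of "ys @ [a]" zs] Cons.prems
    by auto
  moreover have "24 * W + k1 + k2 \<le> 7 * W + length (a # zs) * (24 * W + C)"
    using k1(1) k2(1) by simp
  ultimately show ?case
    using le_trans by blast
qed

text \<open>The only source of iteration in the calculus. Repeated squaring shows that a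
  polynomial-time step alone is not enough, so a bound \<open>q\<close> on the accumulators after
  all prefixes is required. In return, the step has to be efficient only on a set \<open>S\<close>
  containing the states reached.\<close>

lemma polytime_fold:
  assumes l: "polytime e D (\<lambda>x. enc_list (map ea (l x)))"
    and s: "polytime e D (\<lambda>x. eb (s x))"
    and f: "polytime (enc_pair (enc_pair e ea) eb) S (\<lambda>y. eb (f (fst (fst y)) (snd (fst y)) (snd y)))"
    and S: "\<And>x ys a zs. x \<in> D \<Longrightarrow> l x = ys @ a # zs \<Longrightarrow> ((x, a), fold (f x) ys (s x)) \<in> S"
    and q: "poly_bounded e D q"
      "\<And>x ys zs. x \<in> D \<Longrightarrow> l x = ys @ zs \<Longrightarrow> dsize (eb (fold (f x) ys (s x))) \<le> q x"
  shows "polytime e D (\<lambda>x. eb (fold (f x) (l x) (s x)))"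
proof -
  obtain P c k where P: "poly_bounded (enc_pair (enc_pair e ea) eb) S c" "\<And>y. y \<in> S \<Longrightarrow> k y \<le> c y"
    "\<And>y. y \<in> S \<Longrightarrow> runs P (enc_pair (enc_pair e ea) eb y) (eb (f (fst (fst y)) (snd (fst y)) (snd y))) (k y)"
    using f by (rule polytimeE) blast
  obtain p where p: "\<And>y. y \<in> S \<Longrightarrow> c y \<le> poly p (dsize (enc_pair (enc_pair e ea) eb y))"
    using P(1) unfolding poly_bounded_def by blast
  define W where "W = (\<lambda>x. 2 + dsize (enc_list (map ea (l x))) + dsize (e x) + q x)"
  define C where "C = (\<lambda>x. poly p (W x))"
  define b where "b = (\<lambda>x. 7 * W x + dsize (enc_list (map ea (l x))) * (24 * W x + C x))"
  let ?e = "\<lambda>x. Node (enc_list (map ea (l x))) (Node (e x) (eb (s x)))"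
  have W: "poly_bounded e D W"
    unfolding W_def by (intro poly_bounded_intros q polytime_imp_poly_bounded[OF l])
  then have "poly_bounded e D b"
    unfolding b_def C_def
    by (intro poly_bounded_intros poly_bounded_poly q polytime_imp_poly_bounded[OF l])
  \<comment> \<open>The loop reads list, environment and start value as one tree, which is at least
    as large as the environment alone.\<close>
  then have b: "poly_bounded ?e D b"
    by (rule poly_bounded_compose[OF _ poly_bounded_mono[OF poly_bounded_dsize]]) auto
  define Q where "Q = fold_loop # map (shift 1) P"
  have Q: "Q \<noteq> []" "Q ! 0 = fold_loop" "embeds P Q 1"
    using embeds_append[of P "[fold_loop]" "[]"] by (auto simp: Q_def)
  have "polytime ?e D (\<lambda>x. eb (fold (f x) (l x) (s x)))"
  proof (rule polytimeI[OF b Q(1)])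
    fix x assume x: "x \<in> D"
    have size: "dsize (Node (enc_list (map ea zs)) (Node (e x) (eb (fold (f x) ys (s x))))) \<le> W x"
      if "l x = ys @ zs" for ys zs
      using q(2)[OF x that] that by (simp add: W_def dsize_enc_list)
    have step: "\<exists>k\<le>C x. runs P (Node (Node (e x) (ea a)) (eb (fold (f x) ys (s x))))
        (eb (fold (f x) (ys @ [a]) (s x))) k"
      if eq: "l x = ys @ a # zs" for ys a zs
    proof -
      let ?y = "((x, a), fold (f x) ys (s x))"
      note y = S[OF x eq]
      have "dsize (enc_pair (enc_pair e ea) eb ?y) \<le> W x"
        using size[OF eq] by (simp add: enc_pair_def)
      then have "k ?y \<le> C x"
        using P(2)[OF y] p[OF y] poly_nat_mono[of _ "W x" p] unfolding C_def by (meson le_trans)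
      then show ?thesis
        using P(3)[OF y] by (auto simp: enc_pair_def)
    qed
    obtain k where k: "k \<le> 7 * W x + length (l x) * (24 * W x + C x)"
      "eval Q (?e x) fold_loop (eb (fold (f x) (l x) (s x))) k"
      using eval_fold_loop[where l = "l x" and ys = "[]" and zs = "l x" and f = "f x" and s = "s x"
          and c = "e x", OF Q step size append_Nil[symmetric]] by fastforce
    have "length (l x) * (24 * W x + C x) \<le> dsize (enc_list (map ea (l x))) * (24 * W x + C x)"
      using length_le_dsize[of "map ea (l x)"] by (intro mult_right_mono) auto
    then have "k \<le> b x"
      using k(1) unfolding b_def by linarith
    then show "\<exists>k\<le>b x. eval Q (?e x) (Q ! 0) (eb (fold (f x) (l x) (s x))) k"
      using k(2) Q(2) by auto
  qed
  \<comment> \<open>The tree read by the loop is itself computable from the environment, so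
    composition with the identity removes the auxiliary encoding.\<close>
  then show ?thesis
    by (rule polytime_compose[where \<phi> = "\<lambda>x. x"]) (intro polytime_Node l s polytime_env)
qed

section \<open>List operations as bounded folds\<close>

lemma polytime_Nil: "polytime e D (\<lambda>_. enc_list [])"
  by (simp add: polytime_Atom)

lemma polytime_Cons:
  "polytime e D g \<Longrightarrow> polytime e D (\<lambda>x. enc_list (l x)) \<Longrightarrow> polytime e D (\<lambda>x. enc_list (g x # l x))"
  by (simp add: polytime_Node)

lemma polytime_hd:
  assumes "polytime e D (\<lambda>x. enc_list (map ea (l x)))" "\<And>x. x \<in> D \<Longrightarrow> l x \<noteq> []"
  shows "polytime e D (\<lambda>x. ea (hd (l x)))"
proof (rule polytime_cong[OF polytime_unop[OF assms(1), of Left]])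
  fix x assume "x \<in> D"
  then show "ea (hd (l x)) = unop_val Left (enc_list (map ea (l x)))"
    using assms(2)[of x] by (cases "l x") auto
qed

lemma polytime_tl:
  assumes "polytime e D (\<lambda>x. enc_list (l x))"
  shows "polytime e D (\<lambda>x. enc_list (tl (l x)))"
proof (rule polytime_cong[OF polytime_unop[OF assms, of Right]])
  show "enc_list (tl (l x)) = unop_val Right (enc_list (l x))" for x
    by (cases "l x") auto
qed

lemma fold_Cons_map: "fold (\<lambda>a acc. g a # acc) l acc = rev (map g l) @ acc"
  by (induction l arbitrary: acc) auto

lemma polytime_revappend:
  assumes "polytime e D (\<lambda>x. enc_list (l x))" "polytime e D (\<lambda>x. enc_list (k x))"
  shows "polytime e D (\<lambda>x. enc_list (rev (l x) @ k x))"
proof -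
  let ?q = "\<lambda>x. dsize (enc_list (l x)) + dsize (enc_list (k x))"
  have "polytime e D (\<lambda>x. enc_list (fold (\<lambda>a acc. a # acc) (l x) (k x)))"
  proof (rule polytime_fold[where ea = "\<lambda>a. a" and S = UNIV and q = ?q])
    show "polytime (enc_pair (enc_pair e (\<lambda>a. a)) enc_list) UNIV (\<lambda>y. enc_list (snd (fst y) # snd y))"
      by (rule polytime_Cons[OF polytime_fst[OF polytime_snd] polytime_snd[where ea = enc_list]]) auto
    show "poly_bounded e D ?q"
      using assms by (intro poly_bounded_intros polytime_imp_poly_bounded)
    show "dsize (enc_list (fold (\<lambda>a acc. a # acc) ys (k x))) \<le> ?q x" if "l x = ys @ zs" for x ys zs
      using that by (simp add: fold_Cons_map[of "\<lambda>a. a", simplified] dsize_enc_list flip: rev_map)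
  qed (use assms in auto)
  then show ?thesis
    by (simp add: fold_Cons_map[of "\<lambda>a. a", simplified])
qed

lemma polytime_rev:
  assumes "polytime e D (\<lambda>x. enc_list (l x))"
  shows "polytime e D (\<lambda>x. enc_list (rev (l x)))"
  using polytime_revappend[OF assms polytime_Nil] by simp

lemma polytime_append:
  assumes "polytime e D (\<lambda>x. enc_list (l x))" "polytime e D (\<lambda>x. enc_list (k x))"
  shows "polytime e D (\<lambda>x. enc_list (l x @ k x))"
  using polytime_revappend[OF polytime_rev[OF assms(1)] assms(2)] by simp

text \<open>An element is no larger than the list containing it, so one polynomial bound covers the
  values at all elements. It provides the accumulator bounds for maps.\<close>

lemma poly_bounded_elem:
  assumes l: "polytime e D (\<lambda>x. enc_list (map ea (l x)))"
    and g: "polytime (enc_pair e ea) {y. fst y \<in> D \<and> snd y \<in> set (l (fst y))} (\<lambda>y. g (fst y) (snd y))"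
  obtains b where "poly_bounded e D b" "\<And>x a. x \<in> D \<Longrightarrow> a \<in> set (l x) \<Longrightarrow> dsize (g x a) \<le> b x"
proof -
  obtain p where p: "\<And>x a. x \<in> D \<Longrightarrow> a \<in> set (l x) \<Longrightarrow> dsize (g x a) \<le> poly p (dsize (enc_pair e ea (x, a)))"
    using polytime_imp_poly_bounded[OF g] unfolding poly_bounded_def by auto
  let ?b = "\<lambda>x. poly p (1 + dsize (e x) + dsize (enc_list (map ea (l x))))"
  have "dsize (g x a) \<le> ?b x" if "x \<in> D" "a \<in> set (l x)" for x a
  proof -
    have "dsize (enc_pair e ea (x, a)) \<le> 1 + dsize (e x) + dsize (enc_list (map ea (l x)))"
      using dsize_mem_le[of "ea a" "map ea (l x)"] that by (simp add: enc_pair_def)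
    then show ?thesis
      using p[OF that] poly_nat_mono le_trans by meson
  qed
  moreover have "poly_bounded e D ?b"
    by (intro poly_bounded_poly poly_bounded_intros polytime_imp_poly_bounded[OF l])
  ultimately show ?thesis
    using that by blast
qed

lemma polytime_map:
  assumes l: "polytime e D (\<lambda>x. enc_list (map ea (l x)))"
    and g: "polytime (enc_pair e ea) {y. fst y \<in> D \<and> snd y \<in> set (l (fst y))} (\<lambda>y. g (fst y) (snd y))"
  shows "polytime e D (\<lambda>x. enc_list (map (g x) (l x)))"
proof -
  obtain b where b: "poly_bounded e D b" "\<And>x a. x \<in> D \<Longrightarrow> a \<in> set (l x) \<Longrightarrow> dsize (g x a) \<le> b x"
    using poly_bounded_elem[OF l g] by blast
  let ?q = "\<lambda>x. 1 + dsize (enc_list (map ea (l x))) * (1 + b x)"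
  let ?S = "{y. fst (fst y) \<in> D \<and> snd (fst y) \<in> set (l (fst (fst y)))}"
  have "polytime e D (\<lambda>x. enc_list (fold (\<lambda>a acc. g x a # acc) (l x) []))"
  proof (rule polytime_fold[OF l, where S = ?S and q = ?q])
    show "polytime (enc_pair (enc_pair e ea) enc_list) ?S
        (\<lambda>y. enc_list (g (fst (fst y)) (snd (fst y)) # snd y))"
      by (rule polytime_Cons[OF polytime_fst[OF g] polytime_snd[where ea = enc_list]]) auto
    show "poly_bounded e D ?q"
      by (intro poly_bounded_intros b polytime_imp_poly_bounded[OF l])
    show "dsize (enc_list (fold (\<lambda>a acc. g x a # acc) ys [])) \<le> ?q x"
      if "x \<in> D" "l x = ys @ zs" for x ys zs
      using that length_le_dsize[of "map ea (l x)"]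
      by (intro dsize_enc_list_le) (auto simp: fold_Cons_map intro: b(2))
  qed (auto intro: polytime_Atom)
  then show ?thesis
    using polytime_rev[of e D "\<lambda>x. fold (\<lambda>a acc. g x a # acc) (l x) []"] by (simp add: fold_Cons_map)
qed

lemma fold_append_concat: "fold (\<lambda>a acc. acc @ g a) l acc = acc @ concat (map g l)"
  by (induction l arbitrary: acc) auto

lemma polytime_concat_map:
  assumes l: "polytime e D (\<lambda>x. enc_list (map ea (l x)))"
    and g: "polytime (enc_pair e ea) {y. fst y \<in> D \<and> snd y \<in> set (l (fst y))}
      (\<lambda>y. enc_list (g (fst y) (snd y)))"
  shows "polytime e D (\<lambda>x. enc_list (concat (map (g x) (l x))))"
proof -
  obtain b where b: "poly_bounded e D b"
    "\<And>x a. x \<in> D \<Longrightarrow> a \<in> set (l x) \<Longrightarrow> dsize (enc_list (g x a)) \<le> b x"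
    using poly_bounded_elem[OF l g] by blast
  let ?q = "\<lambda>x. 1 + dsize (enc_list (map ea (l x))) * (1 + b x)"
  let ?S = "{y. fst (fst y) \<in> D \<and> snd (fst y) \<in> set (l (fst (fst y)))}"
  \<comment> \<open>Flattening only removes the nodes that hold the inner lists together, so the
    list of lists bounds its concatenation.\<close>
  have size: "dsize (enc_list (concat (map (g x) ys))) \<le> dsize (enc_list (map (\<lambda>a. enc_list (g x a)) ys))" for x ys
    by (induction ys) (auto simp: dsize_enc_list)
  have "polytime e D (\<lambda>x. enc_list (fold (\<lambda>a acc. acc @ g x a) (l x) []))"
  proof (rule polytime_fold[OF l, where S = ?S and q = ?q])
    show "polytime (enc_pair (enc_pair e ea) enc_list) ?S
        (\<lambda>y. enc_list (snd y @ g (fst (fst y)) (snd (fst y))))"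
      by (rule polytime_append[OF polytime_snd[where ea = enc_list] polytime_fst[OF g]]) auto
    show "poly_bounded e D ?q"
      by (intro poly_bounded_intros b polytime_imp_poly_bounded[OF l])
    show "dsize (enc_list (fold (\<lambda>a acc. acc @ g x a) ys [])) \<le> ?q x"
      if "x \<in> D" "l x = ys @ zs" for x ys zs
    proof -
      have "dsize (enc_list (map (\<lambda>a. enc_list (g x a)) ys)) \<le> ?q x"
        using that length_le_dsize[of "map ea (l x)"]
        by (intro dsize_enc_list_le) (auto intro: b(2))
      with size[of x ys] show ?thesis
        by (simp add: fold_append_concat)
    qed
  qed (auto intro: polytime_Atom)
  then show ?thesis
    by (simp add: fold_append_concat)
qed

lemma polytime_filter:
  assumes l: "polytime e D (\<lambda>x. enc_list (map ea (l x)))"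
    and P: "polytime (enc_pair e ea) {y. fst y \<in> D \<and> snd y \<in> set (l (fst y))}
      (\<lambda>y. enc_bool (P (fst y) (snd y)))"
  shows "polytime e D (\<lambda>x. enc_list (map ea (filter (P x) (l x))))"
proof -
  have "polytime e D (\<lambda>x. enc_list (concat (map (\<lambda>a. if P x a then [ea a] else []) (l x))))"
  proof (rule polytime_concat_map[OF l])
    let ?E = "{y. fst y \<in> D \<and> snd y \<in> set (l (fst y))}"
    have "polytime (enc_pair e ea) ?E
      (\<lambda>y. if P (fst y) (snd y) then enc_list [ea (snd y)] else enc_list [])"
      by (intro polytime_if P polytime_Cons polytime_Nil polytime_snd[where ea = ea])
    then show "polytime (enc_pair e ea) ?E
      (\<lambda>y. enc_list (if P (fst y) (snd y) then [ea (snd y)] else []))"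
      by (rule polytime_cong) auto
  qed
  moreover have "concat (map (\<lambda>a. if P x a then [ea a] else []) l) = map ea (filter (P x) l)" for x l
    by (induction l) auto
  ultimately show ?thesis
    by simp
qed

lemma polytime_Bex:
  assumes l: "polytime e D (\<lambda>x. enc_list (map ea (l x)))"
    and P: "polytime (enc_pair e ea) {y. fst y \<in> D \<and> snd y \<in> set (l (fst y))}
      (\<lambda>y. enc_bool (P (fst y) (snd y)))"
  shows "polytime e D (\<lambda>x. enc_bool (\<exists>a\<in>set (l x). P x a))"
proof -
  \<comment> \<open>Some element satisfies the predicate iff the filtered list is nonempty, that is,
    iff its encoding is a node.\<close>
  have "enc_bool (\<exists>a\<in>set k. P x a) = unop_val IsNode (enc_list (map ea (filter (P x) k)))" for x k
  proof (induction k)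
    case (Cons a k)
    then show ?case
      by (cases "P x a") (simp_all add: enc_bool_def)
  qed (simp add: enc_bool_def)
  then show ?thesis
    by (rule polytime_cong[OF polytime_unop[OF polytime_filter[OF l P]]])
qed

lemma polytime_mem:
  assumes "polytime e D (\<lambda>x. enc_nat (n x))" "polytime e D (\<lambda>x. enc_list (map enc_nat (l x)))"
  shows "polytime e D (\<lambda>x. enc_bool (n x \<in> set (l x)))"
proof -
  have "polytime e D (\<lambda>x. enc_bool (\<exists>a\<in>set (l x). n x = a))"
    by (rule polytime_Bex[OF assms(2) polytime_eq_nat[OF polytime_fst[OF assms(1)] polytime_snd]]) auto
  then show ?thesis
    by simp
qed

section \<open>Uncrossing\<close>

text \<open>An entry consists of a cut, a terminal and the location of the terminal.\<close>

type_synonym ('v, 'i) entry = "'v list \<times> 'i \<times> 'v"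

definition crossing :: "'v list \<Rightarrow> 'v list \<Rightarrow> bool" where
  "crossing C D \<longleftrightarrow> (\<exists>v\<in>set C. v \<in> set D) \<and> (\<exists>v\<in>set C. v \<notin> set D) \<and> (\<exists>v\<in>set D. v \<notin> set C)"

lemma crossing_iff_cross: "crossing C D \<longleftrightarrow> cross (set C) (set D)"
  by (auto simp: crossing_def cross_def)

lemma crossing_sym: "crossing C D \<longleftrightarrow> crossing D C"
  by (auto simp: crossing_def)

lemma not_crossing_refl: "\<not> crossing C C"
  by (auto simp: crossing_def)

text \<open>In each case the first result keeps the terminal of \<open>A\<close> and the second that
  of \<open>B\<close>. The union lists \<open>C\<close> and then only the new members of
  \<open>D\<close>, which keeps cuts free of duplicates.\<close>

definition uncross :: "('v, 'i) entry \<Rightarrow> ('v, 'i) entry \<Rightarrow> ('v, 'i) entry \<times> ('v, 'i) entry" where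
  "uncross A B =
    (let C = fst A; D = fst B;
         I = filter (\<lambda>v. v \<in> set D) C; U = C @ filter (\<lambda>v. v \<notin> set C) D
     in if crossing C D then
          if snd (snd A) \<in> set D then ((I, snd A), (U, snd B))
          else if snd (snd B) \<in> set C then ((U, snd A), (I, snd B))
          else ((filter (\<lambda>v. v \<notin> set D) C, snd A), (filter (\<lambda>v. v \<notin> set C) D, snd B))
        else (A, B))"

text \<open>\<open>U\<close> will be the vertices without the sink and \<open>T\<close> the pairs of
  a source terminal and its location. Distinctness serves the running time: it bounds the length of
  a cut by the size of \<open>U\<close>.\<close>

definition entry_ok :: "'v set \<Rightarrow> ('i \<times> 'v) set \<Rightarrow> ('v, 'i) entry \<Rightarrow> bool" where
  "entry_ok U T A \<longleftrightarrow>
    distinct (fst A) \<and> set (fst A) \<subseteq> U \<and> snd (snd A) \<in> set (fst A) \<and> snd A \<in> T"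

text \<open>The number of vertex pairs separated by the cut in a ground set with one point more than
  \<open>U\<close>; the extra point is the sink.\<close>

definition potential :: "'v set \<Rightarrow> ('v, 'i) entry \<Rightarrow> nat" where
  "potential U A = card (set (fst A)) * (card U + 1 - card (set (fst A)))"

definition separates :: "'v \<Rightarrow> 'v \<Rightarrow> ('v, 'i) entry \<Rightarrow> nat" where
  "separates u v A = of_bool (u \<in> set (fst A) \<longleftrightarrow> v \<notin> set (fst A))"

lemma uncross_noncrossing: "\<not> crossing (fst A) (fst B) \<Longrightarrow> uncross A B = (A, B)"
  by (simp add: uncross_def)

lemma snd_uncross: "snd (fst (uncross A B)) = snd A" "snd (snd (uncross A B)) = snd B"
  by (simp_all add: uncross_def Let_def)

lemma entry_ok_uncross:
  assumes "entry_ok U T A" "entry_ok U T B"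
  shows "entry_ok U T (fst (uncross A B)) \<and> entry_ok U T (snd (uncross A B))"
  using assms unfolding entry_ok_def snd_uncross
  by (auto simp: uncross_def Let_def)

text \<open>Submodularity of the cut function for intersection and union, and posimodularity for the
  two differences, both for a single pair \<open>u\<close>, \<open>v\<close>.\<close>

lemma separates_uncross:
  "separates u v (fst (uncross A B)) + separates u v (snd (uncross A B))
    \<le> separates u v A + separates u v B"
  by (auto simp: uncross_def separates_def Let_def of_bool_def)

text \<open>With \<open>x\<close>, \<open>y\<close>, \<open>z\<close>, \<open>w\<close> the sizes of
  intersection, two differences and outside, the potential drops by \<open>2 * y * z\<close> for
  intersection and union and by \<open>2 * x * w\<close> for the differences. Crossing makes
  \<open>x\<close>, \<open>y\<close>, \<open>z\<close> positive.\<close>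

lemma potential_uncross:
  assumes "finite U" "entry_ok U T A" "entry_ok U T B" "crossing (fst A) (fst B)"
  shows "potential U (fst (uncross A B)) + potential U (snd (uncross A B)) < potential U A + potential U B"
proof -
  define C D where "C = set (fst A)" and "D = set (fst B)"
  define x y z where "x = card (C \<inter> D)" and "y = card (C - D)" and "z = card (D - C)"
  have fin: "finite C" "finite D"
    by (auto simp: C_def D_def)
  have pos: "0 < x" "0 < y" "0 < z"
    using assms(4) fin by (auto simp: x_def y_def z_def C_def D_def crossing_def card_gt_0_iff)
  have C: "card C = x + y" and D: "card D = x + z"
    using card_Int_Diff[OF fin(1), of D] card_Int_Diff[OF fin(2), of C]
    by (auto simp: x_def y_def z_def Int_commute)
  have CD: "card (C \<union> D) = x + y + z"
    using card_Un_Int[OF fin] C D by (simp add: x_def)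
  have "card (C \<union> D) \<le> card U"
    using assms by (intro card_mono) (auto simp: C_def D_def entry_ok_def)
  \<comment> \<open>\<open>w\<close> counts the points outside both cuts, including the extra point
    that stands for the sink; hence it is positive.\<close>
  then obtain w where w: "card U + 1 = x + y + z + w" "0 < w"
    using CD by (auto simp: le_iff_add)
  have sub: "card U + 1 - x = y + z + w" "card U + 1 - y = x + z + w" "card U + 1 - z = x + y + w"
    "card U + 1 - (x + y) = z + w" "card U + 1 - (x + z) = y + w" "card U + 1 - (x + y + z) = w"
    unfolding w(1) by simp_all
  have le: "x * (card U + 1 - x) + (x + y + z) * (card U + 1 - (x + y + z))
      < (x + y) * (card U + 1 - (x + y)) + (x + z) * (card U + 1 - (x + z))"
    using pos unfolding sub by (simp add: algebra_simps)
  have diff: "y * (card U + 1 - y) + z * (card U + 1 - z)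
      < (x + y) * (card U + 1 - (x + y)) + (x + z) * (card U + 1 - (x + z))"
    using pos w(2) unfolding sub by (simp add: algebra_simps)
  have sets: "set (filter (\<lambda>v. v \<in> set (fst B)) (fst A)) = C \<inter> D"
    "set (fst A @ filter (\<lambda>v. v \<notin> set (fst A)) (fst B)) = C \<union> D"
    "set (filter (\<lambda>v. v \<notin> set (fst B)) (fst A)) = C - D"
    "set (filter (\<lambda>v. v \<notin> set (fst A)) (fst B)) = D - C"
    by (auto simp: C_def D_def)
  have rhs: "potential U A + potential U B =
      (x + y) * (card U + 1 - (x + y)) + (x + z) * (card U + 1 - (x + z))"
    by (simp add: potential_def C D flip: C_def D_def)
  consider "snd (snd A) \<in> set (fst B)" | "snd (snd A) \<notin> set (fst B)" "snd (snd B) \<in> set (fst A)"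
    | "snd (snd A) \<notin> set (fst B)" "snd (snd B) \<notin> set (fst A)"
    by blast
  then show ?thesis
  proof cases
    case 1
    with assms(4) le show ?thesis
      unfolding rhs
      by (simp only: uncross_def Let_def if_True potential_def fst_conv snd_conv sets CD
          flip: x_def y_def z_def)
  next
    case 2
    with assms(4) le show ?thesis
      unfolding rhs
      by (simp only: uncross_def Let_def if_True if_False potential_def fst_conv snd_conv sets CD
          add.commute flip: x_def y_def z_def)
  next
    case 3
    with assms(4) diff show ?thesis
      unfolding rhs
      by (simp only: uncross_def Let_def if_True if_False potential_def fst_conv snd_conv sets CD
          flip: x_def y_def z_def)
  qed
qed

section \<open>Passes over all pairs of entries\<close>

definition absorb_step where
  "absorb_step B S = (fst (uncross (fst S) B), snd (uncross (fst S) B) # snd S)"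

definition absorb where
  "absorb A L = fold absorb_step L (A, [])"

definition insert_entry where
  "insert_entry A L = fst (absorb A L) # snd (absorb A L)"

text \<open>One pass may leave crossings, since entries that change later are not compared again
  with those met before. What counts is that a pass in which nothing changes has compared every
  pair.\<close>

definition uncross_pass :: "('v, 'i) entry list \<Rightarrow> ('v, 'i) entry list" where
  "uncross_pass F = fold insert_entry F []"

abbreviation entries_ok where
  "entries_ok U T F \<equiv> \<forall>A\<in>set F. entry_ok U T A"

definition noncrossing :: "('v, 'i) entry list \<Rightarrow> bool" where
  "noncrossing F \<longleftrightarrow> (\<forall>A\<in>set F. \<forall>B\<in>set F. \<not> crossing (fst A) (fst B))"

section \<open>Invariants of the passes: legal entries, terminals and separation\<close>

lemma entry_ok_absorb_fold:
  assumes "entry_ok U T (fst S)" "entries_ok U T (snd S)" "entries_ok U T L"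
  shows "entry_ok U T (fst (fold absorb_step L S)) \<and> entries_ok U T (snd (fold absorb_step L S))"
  using assms
proof (induction L arbitrary: S)
  case (Cons B L)
  have "entry_ok U T (fst (absorb_step B S))" "entries_ok U T (snd (absorb_step B S))"
    using Cons.prems entry_ok_uncross[of U T "fst S" B] by (simp_all add: absorb_step_def)
  with Cons.IH[of "absorb_step B S"] Cons.prems show ?case
    by simp
qed simp

lemma entries_ok_insert:
  "entry_ok U T A \<Longrightarrow> entries_ok U T L \<Longrightarrow> entries_ok U T (insert_entry A L)"
  using entry_ok_absorb_fold[of U T "(A, [])" L, folded absorb_def] by (auto simp: insert_entry_def)

lemma entries_ok_insert_fold:
  "entries_ok U T F \<Longrightarrow> entries_ok U T L \<Longrightarrow> entries_ok U T (fold insert_entry F L)"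
  by (induction F arbitrary: L) (auto dest: entries_ok_insert)

lemma entries_ok_pass: "entries_ok U T F \<Longrightarrow> entries_ok U T (uncross_pass F)"
  unfolding uncross_pass_def by (rule entries_ok_insert_fold) auto

lemma entries_ok_passes: "entries_ok U T F \<Longrightarrow> entries_ok U T (fold (\<lambda>_. uncross_pass) ks F)"
  by (induction ks arbitrary: F) (auto dest: entries_ok_pass)

text \<open>Uncrossing changes vertex lists only. Keeping the terminals as a multiset gives both the
  constant number of entries and, as all weights are equal, the constant total weight of each
  terminal.\<close>

lemma mset_absorb_fold:
  "add_mset (snd (fst (fold absorb_step L S))) (mset (map snd (snd (fold absorb_step L S)))) =
    add_mset (snd (fst S)) (mset (map snd (snd S)) + mset (map snd L))"
proof (induction L arbitrary: S)
  case (Cons B L)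
  from Cons.IH[of "absorb_step B S"] show ?case
    by (simp add: absorb_step_def snd_uncross)
qed simp

lemma mset_insert_entry: "mset (map snd (insert_entry A L)) = mset (map snd (A # L))"
  using mset_absorb_fold[of L "(A, [])"] by (simp add: insert_entry_def absorb_def)

lemma mset_insert_fold: "mset (map snd (fold insert_entry F L)) = mset (map snd (F @ L))"
proof (induction F arbitrary: L)
  case (Cons A F)
  have "mset (map snd (fold insert_entry (A # F) L)) = mset (map snd F) + mset (map snd (insert_entry A L))"
    using Cons.IH[of "insert_entry A L"] by simp
  then show ?case
    by (simp only: mset_insert_entry) simp
qed simp

lemma mset_pass: "mset (map snd (uncross_pass F)) = mset (map snd F)"
  by (simp add: uncross_pass_def mset_insert_fold del: mset_map)

lemma mset_passes: "mset (map snd (fold (\<lambda>_. uncross_pass) ks F)) = mset (map snd F)"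
  by (induction ks arbitrary: F) (simp_all add: mset_pass del: mset_map)

lemma length_insert_fold: "length (fold insert_entry F L) = length F + length L"
  using arg_cong[OF mset_insert_fold[of F L], of size] by simp

lemma length_passes: "length (fold (\<lambda>_. uncross_pass) ks F) = length F"
  using arg_cong[OF mset_passes[of ks F], of size] by simp

abbreviation separation :: "'v \<Rightarrow> 'v \<Rightarrow> ('v, 'i) entry list \<Rightarrow> nat" where
  "separation u v F \<equiv> \<Sum>A\<leftarrow>F. separates u v A"

lemma separation_absorb_fold:
  "separation u v (fst (fold absorb_step L S) # snd (fold absorb_step L S))
    \<le> separation u v (fst S # snd S @ L)"
proof (induction L arbitrary: S)
  case (Cons B L)
  from Cons.IH[of "absorb_step B S"] separates_uncross[of u v "fst S" B] show ?case
    by (simp add: absorb_step_def)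
qed simp

lemma separation_insert_fold: "separation u v (fold insert_entry F L) \<le> separation u v (F @ L)"
proof (induction F arbitrary: L)
  case (Cons A F)
  from Cons.IH[of "insert_entry A L"] separation_absorb_fold[of u v L "(A, [])"] show ?case
    by (simp add: insert_entry_def absorb_def)
qed simp

lemma separation_passes: "separation u v (fold (\<lambda>_. uncross_pass) ks F) \<le> separation u v F"
proof (induction ks arbitrary: F)
  case (Cons k ks)
  from Cons.IH[of "uncross_pass F"] separation_insert_fold[of u v F "[]"] show ?case
    by (simp add: uncross_pass_def)
qed simp

section \<open>Termination of the passes\<close>

lemma absorb_fold_noncrossing:
  "\<forall>B\<in>set L. \<not> crossing (fst (fst S)) (fst B) \<Longrightarrow> fold absorb_step L S = (fst S, rev L @ snd S)"
  by (induction L arbitrary: S) (auto simp: absorb_step_def uncross_noncrossing)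

text \<open>Without crossings a pass merely permutes the entries, so surplus passes do no harm and
  the number of passes can be fixed in advance.\<close>

lemma insert_fold_noncrossing:
  assumes "noncrossing (F @ L)"
  shows "mset (fold insert_entry F L) = mset (F @ L)"
  using assms
proof (induction F arbitrary: L)
  case (Cons A F)
  have "insert_entry A L = A # rev L"
    using Cons.prems absorb_fold_noncrossing[of L "(A, [])"]
    by (auto simp: insert_entry_def absorb_def noncrossing_def)
  with Cons.IH[of "A # rev L"] Cons.prems show ?case
    by (simp add: noncrossing_def)
qed simp

lemma noncrossing_pass: "noncrossing F \<Longrightarrow> noncrossing (uncross_pass F)"
  using insert_fold_noncrossing[of F "[]"] mset_eq_setD[of "fold insert_entry F []" F]
  by (simp add: uncross_pass_def noncrossing_def)

lemma noncrossing_passes: "noncrossing F \<Longrightarrow> noncrossing (fold (\<lambda>_. uncross_pass) ks F)"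
  by (induction ks arbitrary: F) (auto dest: noncrossing_pass)

abbreviation total_potential :: "'v set \<Rightarrow> ('v, 'i) entry list \<Rightarrow> nat" where
  "total_potential U F \<equiv> \<Sum>A\<leftarrow>F. potential U A"

text \<open>The first crossing met lowers the potential, and later steps cannot raise it. Without a
  crossing, the traversed list is only reversed, and the comparisons made certify that the inserted
  entry crosses none of it.\<close>

lemma potential_absorb_fold:
  assumes "finite U" "entry_ok U T (fst S)" "entries_ok U T (snd S)" "entries_ok U T L"
  defines "S' \<equiv> fold absorb_step L S"
  shows "total_potential U (fst S' # snd S') < total_potential U (fst S # snd S @ L) \<or>
    S' = (fst S, rev L @ snd S) \<and> (\<forall>B\<in>set L. \<not> crossing (fst (fst S)) (fst B))"
  using assms(2-4) unfolding S'_def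
proof (induction L arbitrary: S)
  case (Cons B L)
  let ?S = "absorb_step B S"
  have ok: "entry_ok U T (fst ?S)" "entries_ok U T (snd ?S)"
    using Cons.prems entry_ok_uncross[of U T "fst S" B] by (auto simp: absorb_step_def)
  note IH = Cons.IH[OF ok]
  show ?case
  proof (cases "crossing (fst (fst S)) (fst B)")
    case True
    then show ?thesis
      using potential_uncross[OF assms(1), of T "fst S" B] IH Cons.prems
      by (auto simp: absorb_step_def sum_list_rev simp flip: rev_map)
  next
    case False
    then have "?S = (fst S, B # snd S)"
      by (simp add: absorb_step_def uncross_noncrossing)
    then show ?thesis
      using IH Cons.prems False by auto
  qed
qed simp

lemma potential_insert_fold:
  assumes "finite U" "entries_ok U T F" "entries_ok U T L"
  shows "total_potential U (fold insert_entry F L) < total_potential U (F @ L) \<or>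
    mset (fold insert_entry F L) = mset (F @ L) \<and> (noncrossing L \<longrightarrow> noncrossing (F @ L))"
  using assms(2-)
proof (induction F arbitrary: L)
  case (Cons A F)
  have IH: "total_potential U (fold insert_entry F (insert_entry A L)) < total_potential U (F @ insert_entry A L) \<or>
    mset (fold insert_entry F (insert_entry A L)) = mset (F @ insert_entry A L) \<and>
    (noncrossing (insert_entry A L) \<longrightarrow> noncrossing (F @ insert_entry A L))"
    using Cons.prems by (intro Cons.IH entries_ok_insert) auto
  \<comment> \<open>Both alternatives give the weak inequality: the second one keeps the multiset of
    entries and hence the sum.\<close>
  then have le: "total_potential U (fold insert_entry F (insert_entry A L)) \<le> total_potential U (F @ insert_entry A L)"
    by (metis less_imp_le mset_map order_refl sum_mset_sum_list)
  consider "total_potential U (insert_entry A L) < total_potential U (A # L)"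
    | "insert_entry A L = A # rev L" "\<forall>B\<in>set L. \<not> crossing (fst A) (fst B)"
    using potential_absorb_fold[OF assms(1), of T "(A, [])" L] Cons.prems
    by (auto simp: insert_entry_def absorb_def)
  then show ?case
  proof cases
    case 1
    with le show ?thesis by auto
  next
    case 2
    have "noncrossing L \<Longrightarrow> noncrossing (A # rev L)"
      using 2(2) crossing_sym not_crossing_refl by (fastforce simp: noncrossing_def)
    moreover have "noncrossing (F @ A # rev L) \<longleftrightarrow> noncrossing (A # F @ L)"
      by (auto simp: noncrossing_def)
    ultimately show ?thesis
      using IH by (auto simp: 2(1) sum_list_rev simp flip: rev_map)
  qed
qed simp

text \<open>A pass over a family with a crossing lowers a natural number, so more passes than the
  initial potential suffice.\<close>

lemma noncrossing_passes_of_potential: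
  assumes "finite U" "entries_ok U T F" "total_potential U F < length ks"
  shows "noncrossing (fold (\<lambda>_. uncross_pass) ks F)"
  using assms(2-)
proof (induction ks arbitrary: F)
  case (Cons k ks)
  consider "total_potential U (uncross_pass F) < total_potential U F"
    | "noncrossing F"
    using potential_insert_fold[OF assms(1) Cons.prems(1), of "[]"]
    by (auto simp: uncross_pass_def noncrossing_def)
  then show ?case
  proof cases
    case 1
    with Cons show ?thesis
      by (auto intro!: Cons.IH dest: entries_ok_pass)
  next
    case 2
    then show ?thesis
      using noncrossing_passes[of F "k # ks"] by simp
  qed
qed simp

lemma potential_le: "finite U \<Longrightarrow> entry_ok U T A \<Longrightarrow> potential U A \<le> (card U + 1) * (card U + 1)"
  unfolding potential_def entry_ok_def
  by (intro mult_le_mono) (auto intro: card_mono le_SucI)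

lemma total_potential_le:
  assumes "finite U" "entries_ok U T F"
  shows "total_potential U F \<le> length F * ((card U + 1) * (card U + 1))"
  using assms(2)
proof (induction F)
  case (Cons A F)
  then show ?case
    using potential_le[OF assms(1), of T A] by simp
qed simp

subsection \<open>Running time of uncrossing\<close>

abbreviation enc_nats :: "nat list \<Rightarrow> data" where
  "enc_nats ns \<equiv> enc_list (map enc_nat ns)"

definition enc_entry :: "(nat, nat) entry \<Rightarrow> data" where
  "enc_entry = enc_pair enc_nats (enc_pair enc_nat enc_nat)"

abbreviation enc_entries :: "(nat, nat) entry list \<Rightarrow> data" where
  "enc_entries F \<equiv> enc_list (map enc_entry F)"

lemma poly_bounded_fst:
  assumes "poly_bounded e D b" "\<And>y. y \<in> D' \<Longrightarrow> fst y \<in> D"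
  shows "poly_bounded (enc_pair e ea) D' (\<lambda>y. b (fst y))"
  by (rule poly_bounded_compose[OF assms(1) poly_bounded_mono[OF poly_bounded_dsize] assms(2)])
     (auto simp: enc_pair_def)

context
  fixes e :: "'x \<Rightarrow> data" and D k l
  assumes k: "polytime e D (\<lambda>x. enc_nats (k x))" and l: "polytime e D (\<lambda>x. enc_nats (l x))"
begin

lemma polytime_mem_elem:
  "polytime (enc_pair e enc_nat) {y. fst y \<in> D \<and> snd y \<in> A (fst y)} (\<lambda>y. enc_bool (snd y \<in> set (l (fst y))))"
  by (rule polytime_mem[OF polytime_snd polytime_fst[OF l]]) auto

lemma polytime_inter: "polytime e D (\<lambda>x. enc_nats (filter (\<lambda>v. v \<in> set (l x)) (k x)))"
  by (rule polytime_filter[OF k polytime_mem_elem])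

lemma polytime_diff: "polytime e D (\<lambda>x. enc_nats (filter (\<lambda>v. v \<notin> set (l x)) (k x)))"
  by (rule polytime_filter[OF k polytime_not[OF polytime_mem_elem]])

lemma polytime_intersects: "polytime e D (\<lambda>x. enc_bool (\<exists>v\<in>set (k x). v \<in> set (l x)))"
  by (rule polytime_Bex[OF k polytime_mem_elem])

lemma polytime_not_subset: "polytime e D (\<lambda>x. enc_bool (\<exists>v\<in>set (k x). v \<notin> set (l x)))"
  by (rule polytime_Bex[OF k polytime_not[OF polytime_mem_elem]])

end

lemma polytime_crossing:
  assumes "polytime e D (\<lambda>x. enc_nats (k x))" "polytime e D (\<lambda>x. enc_nats (l x))"
  shows "polytime e D (\<lambda>x. enc_bool (crossing (k x) (l x)))"
  unfolding crossing_def
  by (intro polytime_and polytime_intersects polytime_not_subset assms)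

lemma polytime_uncross:
  assumes A: "polytime e D (\<lambda>x. enc_entry (A x))" and B: "polytime e D (\<lambda>x. enc_entry (B x))"
  shows "polytime e D (\<lambda>x. enc_pair enc_entry enc_entry (uncross (A x) (B x)))"
proof -
  note A' = polytime_proj1[OF A[unfolded enc_entry_def]] polytime_proj2[OF A[unfolded enc_entry_def]]
  note B' = polytime_proj1[OF B[unfolded enc_entry_def]] polytime_proj2[OF B[unfolded enc_entry_def]]
  note loc = polytime_proj2[OF A'(2)] polytime_proj2[OF B'(2)]
  have entry: "polytime e D (\<lambda>x. enc_nats (k x)) \<Longrightarrow>
      polytime e D (\<lambda>x. enc_pair enc_nat enc_nat (t x)) \<Longrightarrow> polytime e D (\<lambda>x. enc_entry (k x, t x))" for k t
    unfolding enc_entry_def by (rule polytime_Pair)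
  have union: "polytime e D (\<lambda>x. enc_nats (fst (A x) @ filter (\<lambda>v. v \<notin> set (fst (A x))) (fst (B x))))"
    using polytime_append[OF A'(1) polytime_diff[OF B'(1) A'(1)]] by simp
  let ?I = "\<lambda>x. filter (\<lambda>v. v \<in> set (fst (B x))) (fst (A x))"
  let ?U = "\<lambda>x. fst (A x) @ filter (\<lambda>v. v \<notin> set (fst (A x))) (fst (B x))"
  let ?C = "\<lambda>x. filter (\<lambda>v. v \<notin> set (fst (B x))) (fst (A x))"
  let ?D = "\<lambda>x. filter (\<lambda>v. v \<notin> set (fst (A x))) (fst (B x))"
  let ?e = "enc_pair enc_entry enc_entry"
  have "polytime e D (\<lambda>x. if crossing (fst (A x)) (fst (B x)) then
      if snd (snd (A x)) \<in> set (fst (B x)) then ?e ((?I x, snd (A x)), (?U x, snd (B x)))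
      else if snd (snd (B x)) \<in> set (fst (A x)) then ?e ((?U x, snd (A x)), (?I x, snd (B x)))
      else ?e ((?C x, snd (A x)), (?D x, snd (B x)))
    else ?e (A x, B x))"
    by (intro polytime_if_total polytime_Pair[where ea = enc_entry and eb = enc_entry] entry union A B A' B'
        polytime_crossing polytime_mem loc polytime_inter polytime_diff)
  then show ?thesis
    by (rule polytime_cong) (auto simp: uncross_def Let_def)
qed

context
  fixes e :: "'x \<Rightarrow> data" and D U T b
  assumes b: "poly_bounded e D b"
    "\<And>x A. x \<in> D \<Longrightarrow> entry_ok (U x) (T x) A \<Longrightarrow> dsize (enc_entry A) \<le> b x"
begin

text \<open>Sizes during uncrossing are controlled by the invariant and the number of entries.
  Estimating the growth step by step would compound over the iterations.\<close>

lemma dsize_entries_le: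
  "x \<in> D \<Longrightarrow> entries_ok (U x) (T x) F \<Longrightarrow> length F \<le> n \<Longrightarrow> dsize (enc_entries F) \<le> 1 + n * (1 + b x)"
  by (intro dsize_enc_list_le) (auto intro: b(2))

lemma polytime_absorb:
  assumes A: "polytime e D (\<lambda>x. enc_entry (A x))" and L: "polytime e D (\<lambda>x. enc_entries (L x))"
    and ok: "\<And>x. x \<in> D \<Longrightarrow> entry_ok (U x) (T x) (A x)" "\<And>x. x \<in> D \<Longrightarrow> entries_ok (U x) (T x) (L x)"
  shows "polytime e D (\<lambda>x. enc_pair enc_entry enc_entries (absorb (A x) (L x)))"
  unfolding absorb_def
proof (rule polytime_fold[where eb = "enc_pair enc_entry enc_entries" and S = UNIV and f = "\<lambda>_. absorb_step", OF L])
  let ?q = "\<lambda>x. 1 + b x + (1 + dsize (enc_entries (L x)) * (1 + b x))"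
  show "polytime e D (\<lambda>x. enc_pair enc_entry enc_entries (A x, []))"
    using polytime_Pair[where ea = enc_entry and eb = enc_entries and h = "\<lambda>_. []", OF A] polytime_Nil[of e D] by simp
  show "polytime (enc_pair (enc_pair e enc_entry) (enc_pair enc_entry enc_entries)) UNIV
     (\<lambda>y. enc_pair enc_entry enc_entries (absorb_step (snd (fst y)) (snd y)))"
  proof -
    let ?e = "enc_pair (enc_pair e enc_entry) (enc_pair enc_entry enc_entries)"
    have B: "polytime ?e UNIV (\<lambda>y. enc_entry (snd (fst y)))"
      by (rule polytime_fst[OF polytime_snd[where D' = UNIV]]) simp
    have S: "polytime ?e UNIV (\<lambda>y. enc_pair enc_entry enc_entries (snd y))"
      by (rule polytime_snd)
    note un = polytime_uncross[OF polytime_proj1[OF S] B]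
    show ?thesis
      unfolding absorb_step_def
      using polytime_Pair[where ea = enc_entry and eb = enc_entries and
          h = "\<lambda>y. snd (uncross (fst (snd y)) (snd (fst y))) # snd (snd y)", OF polytime_proj1[OF un]]
        polytime_Cons[OF polytime_proj2[OF un] polytime_proj2[OF S]] by simp
  qed
  show "poly_bounded e D ?q"
    by (intro poly_bounded_intros b(1) polytime_imp_poly_bounded[OF L])
  fix x ys zs assume x: "x \<in> D" and l: "L x = ys @ zs"
  let ?S = "fold absorb_step ys (A x, [])"
  have S: "entry_ok (U x) (T x) (fst ?S)" "entries_ok (U x) (T x) (snd ?S)"
    using entry_ok_absorb_fold[of "U x" "T x" "(A x, [])" ys] ok[OF x] l by auto
  \<comment> \<open>Each step consumes one entry and emits one, as the sizes of the multisets of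
    terminals show.\<close>
  have "length (snd ?S) = length ys"
    using arg_cong[OF mset_absorb_fold[of ys "(A x, [])"], of size] by simp
  then have len: "length (snd ?S) \<le> dsize (enc_entries (L x))"
    using length_le_dsize[of "map enc_entry (L x)"] l by simp
  then show "dsize (enc_pair enc_entry enc_entries ?S) \<le> ?q x"
    using dsize_entries_le[OF x S(2) len] b(2)[OF x S(1)] by (simp add: enc_pair_def)
qed simp_all

lemma polytime_insert_entry:
  assumes A: "polytime e D (\<lambda>x. enc_entry (A x))" and L: "polytime e D (\<lambda>x. enc_entries (L x))"
    and ok: "\<And>x. x \<in> D \<Longrightarrow> entry_ok (U x) (T x) (A x)" "\<And>x. x \<in> D \<Longrightarrow> entries_ok (U x) (T x) (L x)"
  shows "polytime e D (\<lambda>x. enc_entries (insert_entry (A x) (L x)))"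
proof -
  note * = polytime_absorb[OF assms]
  show ?thesis
    using polytime_Cons[OF polytime_proj1[OF *] polytime_proj2[OF *]] by (simp add: insert_entry_def)
qed

end

text \<open>Insertion is known to be efficient only under the invariant, so the fold runs on the
  states \<open>?S\<close> that satisfy it.\<close>

lemma polytime_pass:
  fixes e :: "'x \<Rightarrow> data"
  assumes b: "poly_bounded e D b"
    "\<And>x A. x \<in> D \<Longrightarrow> entry_ok (U x) (T x) A \<Longrightarrow> dsize (enc_entry A) \<le> b x"
    and F: "polytime e D (\<lambda>x. enc_entries (F x))"
    and ok: "\<And>x. x \<in> D \<Longrightarrow> entries_ok (U x) (T x) (F x)"
  shows "polytime e D (\<lambda>x. enc_entries (uncross_pass (F x)))"
  unfolding uncross_pass_def
proof (rule polytime_fold[where eb = enc_entries and f = "\<lambda>_. insert_entry", OF F])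
  let ?S = "{y. fst (fst y) \<in> D \<and> entry_ok (U (fst (fst y))) (T (fst (fst y))) (snd (fst y)) \<and>
    entries_ok (U (fst (fst y))) (T (fst (fst y))) (snd y)}"
  let ?q = "\<lambda>x. 1 + dsize (enc_entries (F x)) * (1 + b x)"
  show "polytime (enc_pair (enc_pair e enc_entry) enc_entries) ?S
     (\<lambda>y. enc_entries (insert_entry (snd (fst y)) (snd y)))"
  proof (rule polytime_insert_entry)
    show "poly_bounded (enc_pair (enc_pair e enc_entry) enc_entries) ?S (\<lambda>y. b (fst (fst y)))"
      by (rule poly_bounded_fst[OF poly_bounded_fst[OF b(1), where D' = "{y. fst y \<in> D}"]]) auto
    show "polytime (enc_pair (enc_pair e enc_entry) enc_entries) ?S (\<lambda>y. enc_entry (snd (fst y)))"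
      by (rule polytime_fst[OF polytime_snd[where D' = UNIV]]) simp
  qed (auto intro: b(2) polytime_snd)
  show "polytime e D (\<lambda>x. enc_entries [])"
    by (simp add: polytime_Atom)
  show "poly_bounded e D ?q"
    by (intro poly_bounded_intros b(1) polytime_imp_poly_bounded[OF F])
  show "((x, a), fold insert_entry ys []) \<in> ?S" if "x \<in> D" "F x = ys @ a # zs" for x ys a zs
    using ok[OF that(1)] that entries_ok_insert_fold[where U = "U x" and T = "T x" and F = ys and L = "[]"] by auto
  show "dsize (enc_entries (fold insert_entry ys [])) \<le> ?q x" if "x \<in> D" "F x = ys @ zs" for x ys zs
    using ok[OF that(1)] that entries_ok_insert_fold[where U = "U x" and T = "T x" and F = ys and L = "[]"]
      length_le_dsize[of "map enc_entry (F x)"]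
    by (intro dsize_entries_le[of e D b U T] b) (auto simp: length_insert_fold)
qed

text \<open>The same bound \<open>b\<close> holds before and after every pass, so the number of
  passes enters the running time as a factor and not as a nesting depth of polynomials.\<close>

lemma polytime_passes:
  fixes e :: "'x \<Rightarrow> data"
  assumes b: "poly_bounded e D b"
    "\<And>x A. x \<in> D \<Longrightarrow> entry_ok (U x) (T x) A \<Longrightarrow> dsize (enc_entry A) \<le> b x"
    and F: "polytime e D (\<lambda>x. enc_entries (F x))"
    and ok: "\<And>x. x \<in> D \<Longrightarrow> entries_ok (U x) (T x) (F x)"
    and ks: "polytime e D (\<lambda>x. enc_list (map ea (ks x)))"
  shows "polytime e D (\<lambda>x. enc_entries (fold (\<lambda>_. uncross_pass) (ks x) (F x)))"
proof (rule polytime_fold[where eb = enc_entries and f = "\<lambda>_ _. uncross_pass", OF ks F])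
  let ?S = "{y. fst (fst y) \<in> D \<and> entries_ok (U (fst (fst y))) (T (fst (fst y))) (snd y)}"
  let ?q = "\<lambda>x. 1 + dsize (enc_entries (F x)) * (1 + b x)"
  show "polytime (enc_pair (enc_pair e ea) enc_entries) ?S (\<lambda>y. enc_entries (uncross_pass (snd y)))"
  proof (rule polytime_pass)
    show "poly_bounded (enc_pair (enc_pair e ea) enc_entries) ?S (\<lambda>y. b (fst (fst y)))"
      by (rule poly_bounded_fst[OF poly_bounded_fst[OF b(1), where D' = "{y. fst y \<in> D}"]]) auto
  qed (auto intro: b(2) polytime_snd)
  show "poly_bounded e D ?q"
    by (intro poly_bounded_intros b(1) polytime_imp_poly_bounded[OF F])
  show "((x, a), fold (\<lambda>_. uncross_pass) ys (F x)) \<in> ?S" if "x \<in> D" for x ys a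
    using ok[OF that] that entries_ok_passes[where F = "F x" and U = "U x" and T = "T x" and ks = ys] by auto
  show "dsize (enc_entries (fold (\<lambda>_. uncross_pass) ys (F x))) \<le> ?q x" if "x \<in> D" for x ys
    using ok[OF that] that entries_ok_passes[where F = "F x" and U = "U x" and T = "T x" and ks = ys]
      length_le_dsize[of "map enc_entry (F x)"]
    by (intro dsize_entries_le[of e D b U T] b) (auto simp: length_passes)
qed

section \<open>The algorithm\<close>

text \<open>Numbers that control loops are kept in unary, as lengths of lists, because folds over
  lists are the only loops; this is their multiplication.\<close>

definition units_times :: "'a list \<Rightarrow> 'b list \<Rightarrow> nat list" where
  "units_times k l = concat (map (\<lambda>_. map (\<lambda>_. 0) l) k)"

lemma length_units_times: "length (units_times k l) = length k * length l"
  by (simp add: units_times_def length_concat sum_list_triv comp_def)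

lemma polytime_units_times:
  assumes "polytime e D (\<lambda>x. enc_list (map ea (k x)))" "polytime e D (\<lambda>x. enc_list (map eb (l x)))"
  shows "polytime e D (\<lambda>x. enc_nats (units_times (k x) (l x)))"
proof -
  let ?E = "{y. fst y \<in> D \<and> snd y \<in> set (k (fst y))}"
  have "polytime (enc_pair e ea) ?E (\<lambda>y. enc_list (map (\<lambda>_. enc_nat 0) (l (fst y))))"
  proof (rule polytime_map[where ea = eb])
    show "polytime (enc_pair e ea) ?E (\<lambda>y. enc_list (map eb (l (fst y))))"
      by (rule polytime_fst[OF assms(2)]) simp
  qed (simp add: enc_nat_def polytime_Atom)
  then have "polytime e D (\<lambda>x. enc_list (concat (map (\<lambda>_. map (\<lambda>_. enc_nat 0) (l x)) (k x))))"
    by (rule polytime_concat_map[OF assms(1), where g = "\<lambda>x _. map (\<lambda>_. enc_nat 0) (l x)"])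
  then show ?thesis
    by (simp add: units_times_def map_concat comp_def)
qed

definition count_step :: "nat \<Rightarrow> nat \<times> nat list \<Rightarrow> nat \<times> nat list" where
  "count_step _ S = (fst S + 1, fst S # snd S)"

lemma count_fold: "fold count_step l (0, []) = (length l, rev [0..<length l])"
proof -
  have "fold count_step l (m, rev [0..<m]) = (m + length l, rev [0..<m + length l])" for m
  proof (induction l arbitrary: m)
    case (Cons a l)
    from Cons.IH[of "Suc m"] show ?case
      by (simp add: count_step_def)
  qed simp
  from this[of 0] show ?thesis
    by simp
qed

lemma dsize_enc_nat: "dsize (enc_nat m) \<le> 2 + m"
proof -
  have "m < 2 ^ m"
    by (rule less_exp)
  then have "floorlog 2 m \<le> m"
    by (intro floorlog_leI) auto
  then show ?thesis
    by (simp add: enc_nat_def)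
qed

text \<open>Converts a unary number into binary and at the same time lists all smaller numbers,
  which later serve as radii.\<close>

lemma polytime_count:
  assumes "polytime e D (\<lambda>x. enc_nats (l x))"
  shows "polytime e D (\<lambda>x. enc_pair enc_nat enc_nats (length (l x), rev [0..<length (l x)]))"
proof -
  let ?e = "enc_pair enc_nat enc_nats"
  let ?L = "\<lambda>x. dsize (enc_nats (l x))"
  let ?q = "\<lambda>x. 1 + (2 + ?L x) + (1 + ?L x * (1 + (2 + ?L x)))"
  have "polytime e D (\<lambda>x. ?e (fold count_step (l x) (0, [])))"
  proof (rule polytime_fold[where eb = ?e and f = "\<lambda>_. count_step" and S = UNIV, OF assms])
    show "polytime e D (\<lambda>x. ?e (0, []))"
      by (simp add: enc_pair_def enc_nat_def polytime_Node polytime_Atom)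
    show "polytime (enc_pair (enc_pair e enc_nat) ?e) UNIV (\<lambda>y. ?e (count_step (snd (fst y)) (snd y)))"
    proof -
      let ?E = "enc_pair (enc_pair e enc_nat) ?e"
      have S: "polytime ?E UNIV (\<lambda>y. ?e (snd y))"
        by (rule polytime_snd)
      note m = polytime_proj1[OF S] and ms = polytime_proj2[OF S]
      have one: "polytime ?E UNIV (\<lambda>y. enc_nat 1)"
        by (simp add: enc_nat_def polytime_Atom)
      show ?thesis
        unfolding count_step_def
        using polytime_Pair[where ea = enc_nat and eb = enc_nats and h = "\<lambda>y. fst (snd y) # snd (snd y)",
            OF polytime_add_nat[OF m one]] polytime_Cons[OF m ms] by simp
    qed
    show "poly_bounded e D ?q"
      by (intro poly_bounded_intros polytime_imp_poly_bounded[OF assms])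
    show "dsize (?e (fold count_step ys (0, []))) \<le> ?q x" if "l x = ys @ zs" for x ys zs
    proof -
      have len: "length ys \<le> ?L x"
        using length_le_dsize[of "map enc_nat (l x)"] that by simp
      have "dsize (enc_nat m) \<le> 2 + ?L x" if "m \<le> length ys" for m
        using dsize_enc_nat[of m] len that by simp
      then have "dsize (enc_nats (rev [0..<length ys])) \<le> 1 + ?L x * (1 + (2 + ?L x))"
        by (intro dsize_enc_list_le) (use len in auto)
      moreover have "dsize (enc_nat (length ys)) \<le> 2 + ?L x"
        using dsize_enc_nat[of "length ys"] len by linarith
      ultimately show ?thesis
        by (simp add: count_fold enc_pair_def)
    qed
  qed simp_all
  then show ?thesis
    by (simp add: count_fold)
qed

section \<open>Looking up the distance table of a terminal\<close>

definition select_step :: "nat \<Rightarrow> nat list \<Rightarrow> 'a list list \<times> 'a list \<Rightarrow> 'a list list \<times> 'a list" where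
  "select_step i c S = (tl (fst S), if i \<in> set c then hd (fst S) else snd S)"

text \<open>The member of \<open>ts\<close> at the last position where the member of \<open>cs\<close> contains \<open>i\<close>.\<close>

definition select :: "nat \<Rightarrow> nat list list \<Rightarrow> 'a list list \<Rightarrow> 'a list" where
  "select i cs ts = snd (fold (select_step i) cs (ts, []))"

text \<open>Both lists are walked in parallel and a later match overwrites an earlier one. The
  assumed match rules out that the initial value \<open>[]\<close> is returned.\<close>

lemma select_map:
  assumes "a \<in> set as" "i \<in> set (c a)"
  shows "select i (map c as) (map t as) = t (last (filter (\<lambda>a. i \<in> set (c a)) as))"
proof -
  have "snd (fold (select_step i) (map c as) (map t as, s)) =
    (if \<exists>a\<in>set as. i \<in> set (c a) then t (last (filter (\<lambda>a. i \<in> set (c a)) as)) else s)" for s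
    by (induction as arbitrary: s) (auto simp: select_step_def filter_empty_conv)
  then show ?thesis
    using assms by (auto simp: select_def)
qed

text \<open>Describes the states of the walk: the remaining tables form a suffix, nonempty while
  commodities remain, and the stored table is \<open>[]\<close> or one from the input. This
  justifies \<open>hd\<close> and bounds the sizes.\<close>

lemma select_fold:
  assumes "length ys \<le> length ts"
  shows "fst (fold (select_step i) ys (ts, [])) = drop (length ys) ts"
    "snd (fold (select_step i) ys (ts, [])) \<in> insert [] (set ts)"
proof -
  have "fst (fold (select_step i) ys (ts, [])) = drop (length ys) ts \<and>
    snd (fold (select_step i) ys (ts, [])) \<in> insert [] (set ts)"
    using assms
  proof (induction ys rule: rev_induct)
    case (snoc y ys)
    then have "hd (drop (length ys) ts) \<in> set ts"
      by (metis Suc_le_eq hd_drop_conv_nth length_append_singleton nth_mem)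
    with snoc show ?case
      by (auto simp: select_step_def drop_Suc tl_drop)
  qed simp
  then show "fst (fold (select_step i) ys (ts, [])) = drop (length ys) ts"
    "snd (fold (select_step i) ys (ts, [])) \<in> insert [] (set ts)"
    by auto
qed

lemma dsize_drop_le: "dsize (enc_list (drop n xs)) \<le> dsize (enc_list xs)"
  by (induction xs arbitrary: n) (auto simp: drop_Cons' intro: le_SucI trans_le_add2)

lemma polytime_select:
  fixes ts :: "'x \<Rightarrow> 'a list list"
  assumes i: "polytime e D (\<lambda>x. enc_nat (i x))"
    and cs: "polytime e D (\<lambda>x. enc_list (map enc_nats (cs x)))"
    and ts: "polytime e D (\<lambda>x. enc_list (map (\<lambda>t. enc_list (map ez t)) (ts x)))"
    and len: "\<And>x. x \<in> D \<Longrightarrow> length (cs x) = length (ts x)"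
  shows "polytime e D (\<lambda>x. enc_list (map ez (select (i x) (cs x) (ts x))))"
proof -
  let ?et = "\<lambda>t :: 'a list. enc_list (map ez t)"
  let ?ets = "\<lambda>ts :: 'a list list. enc_list (map ?et ts)"
  let ?e = "enc_pair ?ets ?et"
  let ?S = "{y :: ('x \<times> nat list) \<times> 'a list list \<times> 'a list. fst (fst y) \<in> D \<and> fst (snd y) \<noteq> []}"
  let ?q = "\<lambda>x. 2 + dsize (?ets (ts x)) + dsize (?ets (ts x))"
  have "polytime e D (\<lambda>x. ?e (fold (select_step (i x)) (cs x) (ts x, [])))"
  proof (rule polytime_fold[where eb = ?e and f = "\<lambda>x. select_step (i x)" and S = ?S, OF cs])
    show "polytime e D (\<lambda>x. ?e (ts x, []))"
      using ts by (simp add: enc_pair_def polytime_Node polytime_Atom)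
    let ?E = "enc_pair (enc_pair e enc_nats) ?e"
    have S: "polytime ?E ?S (\<lambda>y. ?e (snd y))"
      by (rule polytime_snd)
    have c: "polytime ?E ?S (\<lambda>y. enc_nats (snd (fst y)))"
      by (rule polytime_fst[OF polytime_snd[where D' = UNIV]]) simp
    have i': "polytime ?E ?S (\<lambda>y. enc_nat (i (fst (fst y))))"
      by (rule polytime_fst[OF polytime_fst[OF i, where D' = "{y. fst y \<in> D}"]]) auto
    have "polytime ?E ?S (\<lambda>y. ?ets (tl (fst (snd y))))"
      using polytime_tl[OF polytime_proj1[OF S]] by (simp add: map_tl)
    moreover have "polytime ?E ?S (\<lambda>y. if i (fst (fst y)) \<in> set (snd (fst y)) then ?et (hd (fst (snd y)))
        else ?et (snd (snd y)))"
      by (intro polytime_if_total polytime_mem i' c polytime_proj2[OF S]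
          polytime_hd[where ea = ?et, OF polytime_proj1[OF S]]) auto
    ultimately have "polytime ?E ?S (\<lambda>y. Node (?ets (tl (fst (snd y))))
        (if i (fst (fst y)) \<in> set (snd (fst y)) then ?et (hd (fst (snd y))) else ?et (snd (snd y))))"
      by (rule polytime_Node)
    then show "polytime ?E ?S (\<lambda>y. ?e (select_step (i (fst (fst y))) (snd (fst y)) (snd y)))"
      by (rule polytime_cong) (simp add: enc_pair_def select_step_def)
    show "poly_bounded e D ?q"
      by (intro poly_bounded_intros polytime_imp_poly_bounded[OF ts])
    show "((x, a), fold (select_step (i x)) ys (ts x, [])) \<in> ?S" if "x \<in> D" "cs x = ys @ a # zs" for x ys a zs
      using len[OF that(1)] that select_fold(1)[of ys "ts x" "i x"] by auto
    show "dsize (?e (fold (select_step (i x)) ys (ts x, []))) \<le> ?q x" if x: "x \<in> D" "cs x = ys @ zs" for x ys zs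
    proof -
      have le: "length ys \<le> length (ts x)"
        using len[OF x(1)] x(2) by simp
      have "dsize (?et (snd (fold (select_step (i x)) ys (ts x, [])))) \<le> 1 + dsize (?ets (ts x))"
        using select_fold(2)[OF le, of "i x"] dsize_mem_le[of _ "map ?et (ts x)"]
        by (auto simp: floorlog_def intro: le_SucI)
      moreover have "dsize (?ets (drop (length ys) (ts x))) \<le> dsize (?ets (ts x))"
        using dsize_drop_le[of "length ys" "map ?et (ts x)"] by (simp add: drop_map)
      ultimately show ?thesis
        by (simp add: enc_pair_def select_fold(1)[OF le])
    qed
  qed
  from polytime_proj2[OF this] show ?thesis
    by (simp add: select_def)
qed

section \<open>Balls in a rational distance table\<close>

abbreviation enc_dist :: "nat \<times> nat \<times> rat \<Rightarrow> data" where
  "enc_dist \<equiv> enc_pair enc_nat (enc_pair enc_nat enc_rat)"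

lemma polytime_rat_le:
  assumes q: "polytime e D (\<lambda>x. enc_rat (q x))"
    and N: "polytime e D (\<lambda>x. enc_nat (N x))" and m: "polytime e D (\<lambda>x. enc_nat (m x))"
  shows "polytime e D (\<lambda>x. enc_bool (q x * of_nat (N x) \<le> of_nat (m x)))"
proof -
  have enc: "enc_rat r = enc_pair Atom Atom (quotient_of r)" for r
    by (simp add: enc_rat_def enc_pair_def split: prod.split)
  note q' = polytime_proj1[OF q[unfolded enc]] polytime_proj2[OF q[unfolded enc]]
  \<comment> \<open>The denominator of a quotient in normal form is positive, so multiplying by it
    turns the comparison into one of integers.\<close>
  have "polytime e D (\<lambda>x. enc_bool (\<not> int (m x) * snd (quotient_of (q x)) < fst (quotient_of (q x)) * int (N x)))"
    using N m unfolding enc_nat_def by (intro polytime_not polytime_less_int polytime_mult_int q')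
  moreover have "(\<not> int m * snd (quotient_of r) < fst (quotient_of r) * int N) \<longleftrightarrow> r * of_nat N \<le> of_nat m"
    for r :: rat and m N
  proof -
    obtain a b where ab: "quotient_of r = (a, b)"
      by fastforce
    have b: "0 < b" and r: "r = of_int a / of_int b"
      using quotient_of_denom_pos[OF ab] quotient_of_div[OF ab] by auto
    have "r * of_nat N \<le> of_nat m \<longleftrightarrow> (of_int (a * int N) :: rat) \<le> of_int (int m * b)"
      using b by (simp add: r field_simps)
    then show ?thesis
      unfolding of_int_le_iff by (auto simp: ab)
  qed
  ultimately show ?thesis
    by simp
qed

definition dist_ball :: "(nat \<times> nat \<times> rat) list \<Rightarrow> nat \<Rightarrow> nat \<Rightarrow> nat \<Rightarrow> nat list" where
  "dist_ball t r N m =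
    map (\<lambda>z. fst (snd z)) (filter (\<lambda>z. fst z = r \<and> snd (snd z) * of_nat N \<le> of_nat m) t)"

lemma polytime_dist_ball:
  assumes t: "polytime e D (\<lambda>x. enc_list (map enc_dist (t x)))"
    and r: "polytime e D (\<lambda>x. enc_nat (r x))"
    and N: "polytime e D (\<lambda>x. enc_nat (N x))" and m: "polytime e D (\<lambda>x. enc_nat (m x))"
  shows "polytime e D (\<lambda>x. enc_nats (dist_ball (t x) (r x) (N x) (m x)))"
proof -
  have z: "polytime (enc_pair e enc_dist) E (\<lambda>y. enc_dist (snd y))" for E
    by (rule polytime_snd)
  note z' = polytime_proj1[OF z] polytime_proj1[OF polytime_proj2[OF z]] polytime_proj2[OF polytime_proj2[OF z]]
  let ?E = "{y. fst y \<in> D \<and> snd y \<in> set (t (fst y))}"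
  have "polytime (enc_pair e enc_dist) ?E (\<lambda>y. enc_bool
      (fst (snd y) = r (fst y) \<and> snd (snd (snd y)) * of_nat (N (fst y)) \<le> of_nat (m (fst y))))"
    by (intro polytime_and polytime_eq_nat polytime_rat_le z' polytime_fst[OF r] polytime_fst[OF N]
        polytime_fst[OF m]) auto
  from polytime_filter[OF t this]
  have "polytime e D (\<lambda>x. enc_list (map (\<lambda>z. enc_nat (fst (snd z))) (filter (\<lambda>z. fst z = r x \<and>
      snd (snd z) * of_nat (N x) \<le> of_nat (m x)) (t x))))"
    by (rule polytime_map[OF _ z'(2)])
  then show ?thesis
    by (simp add: dist_ball_def comp_def)
qed

text \<open>As \<open>us\<close> is distinct, the table has exactly one row for \<open>r\<close>; so
  the ball lists each vertex as often as \<open>vs\<close> does.\<close>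

lemma dist_ball_table:
  assumes "r \<in> set us" "distinct us"
  shows "dist_ball [(u, v, q u v). u \<leftarrow> us, v \<leftarrow> vs] r N m = filter (\<lambda>v. q r v * of_nat N \<le> of_nat m) vs"
proof -
  have "dist_ball (map (\<lambda>v. (u, v, q u v)) ws) r N m =
    (if u = r then filter (\<lambda>v. q r v * of_nat N \<le> of_nat m) ws else [])" for u ws
    by (induction ws) (auto simp: dist_ball_def)
  moreover have "dist_ball (s @ t) r N m = dist_ball s r N m @ dist_ball t r N m" for s t
    by (simp add: dist_ball_def)
  ultimately have "distinct us \<Longrightarrow> dist_ball [(u, v, q u v). u \<leftarrow> us, v \<leftarrow> vs] r N m =
    (if r \<in> set us then filter (\<lambda>v. q r v * of_nat N \<le> of_nat m) vs else [])"
    by (induction us) (auto simp: dist_ball_def)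
  then show ?thesis
    using assms by simp
qed

subsection \<open>Reading the input\<close>

type_synonym input = "(nat, nat) cscp \<times> (nat \<Rightarrow> nat \<Rightarrow> nat \<Rightarrow> rat)"

definition enc_in :: "input \<Rightarrow> data" where
  "enc_in x = enc_input (fst x) (snd x)"

definition inputs :: "input set" where
  "inputs = {x. is_cscp (fst x) \<and> mcp_lp_feasible (fst x) (\<lambda>a u v. of_rat (snd x a u v))}"

definition vertex_list :: "input \<Rightarrow> nat list" where
  "vertex_list x = sorted_list_of_set (verts (fst x))"

definition terminals :: "input \<Rightarrow> (nat \<times> nat) list" where
  "terminals x = map (\<lambda>i. (i, loc (fst x) i)) (sorted_list_of_set (all_terminals (fst x)))"

definition commodities :: "input \<Rightarrow> nat list list" where
  "commodities x = map (\<lambda>a. sorted_list_of_set (com (fst x) a)) [0..<ncom (fst x)]"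

definition dist_table :: "input \<Rightarrow> nat \<Rightarrow> (nat \<times> nat \<times> rat) list" where
  "dist_table x a = [(u, v, snd x a u v). u \<leftarrow> vertex_list x, v \<leftarrow> vertex_list x]"

definition dist_tables :: "input \<Rightarrow> (nat \<times> nat \<times> rat) list list" where
  "dist_tables x = map (dist_table x) [0..<ncom (fst x)]"

lemma enc_in_eq:
  obtains E where "\<And>x. enc_in x = enc_list
    [enc_nats (vertex_list x), E x, enc_nat (sink (fst x)), enc_list (map (enc_pair enc_nat enc_nat) (terminals x)),
     enc_list (map enc_nats (commodities x)), enc_list (map (\<lambda>t. enc_list (map enc_dist t)) (dist_tables x))]"
proof
  \<comment> \<open>The witness for \<open>E\<close> is a projection of the encoding itself, so the
    comprehension for the edges need not be repeated.\<close>
  show "enc_in x = enc_list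
    [enc_nats (vertex_list x),
     unop_val Left (unop_val Right (enc_in x)), enc_nat (sink (fst x)), enc_list (map (enc_pair enc_nat enc_nat) (terminals x)),
     enc_list (map enc_nats (commodities x)), enc_list (map (\<lambda>t. enc_list (map enc_dist t)) (dist_tables x))]" for x
    by (simp add: enc_in_def enc_input_def Let_def vertex_list_def terminals_def commodities_def
        dist_tables_def dist_table_def enc_set_def enc_pair_def map_concat comp_def)
qed

lemma polytime_input:
  shows polytime_vertex_list: "polytime enc_in D (\<lambda>x. enc_nats (vertex_list x))"
    and polytime_sink: "polytime enc_in D (\<lambda>x. enc_nat (sink (fst x)))"
    and polytime_terminals: "polytime enc_in D (\<lambda>x. enc_list (map (enc_pair enc_nat enc_nat) (terminals x)))"
    and polytime_commodities: "polytime enc_in D (\<lambda>x. enc_list (map enc_nats (commodities x)))"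
    and polytime_dist_tables:
      "polytime enc_in D (\<lambda>x. enc_list (map (\<lambda>t. enc_list (map enc_dist t)) (dist_tables x)))"
proof -
  obtain E where E: "\<And>x. enc_in x = enc_list
    [enc_nats (vertex_list x), E x, enc_nat (sink (fst x)), enc_list (map (enc_pair enc_nat enc_nat) (terminals x)),
     enc_list (map enc_nats (commodities x)), enc_list (map (\<lambda>t. enc_list (map enc_dist t)) (dist_tables x))]"
    using enc_in_eq by blast
  note R = polytime_unop[where f = Right]
  note 0 = polytime_env[of enc_in D]
  note 2 = R[OF R[OF 0]]
  note 3 = R[OF 2]
  show "polytime enc_in D (\<lambda>x. enc_nats (vertex_list x))"
    by (rule polytime_cong[OF polytime_unop[where f = Left, OF 0]]) (simp add: E)
  show "polytime enc_in D (\<lambda>x. enc_nat (sink (fst x)))"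
    by (rule polytime_cong[OF polytime_unop[where f = Left, OF 2]]) (simp add: E)
  show "polytime enc_in D (\<lambda>x. enc_list (map (enc_pair enc_nat enc_nat) (terminals x)))"
    by (rule polytime_cong[OF polytime_unop[where f = Left, OF 3]]) (simp add: E)
  show "polytime enc_in D (\<lambda>x. enc_list (map enc_nats (commodities x)))"
    by (rule polytime_cong[OF polytime_unop[where f = Left, OF R[OF 3]]]) (simp add: E)
  show "polytime enc_in D (\<lambda>x. enc_list (map (\<lambda>t. enc_list (map enc_dist t)) (dist_tables x)))"
    by (rule polytime_cong[OF polytime_unop[where f = Left, OF R[OF R[OF 3]]]]) (simp add: E)
qed

subsection \<open>Unit cuts and the final family\<close>

text \<open>The number \<open>n k\<^sup>2\<close> in unary.\<close>

definition granules :: "input \<Rightarrow> nat list" where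
  "granules x = units_times (vertex_list x) (units_times (commodities x) (commodities x))"

definition granularity :: "input \<Rightarrow> nat" where
  "granularity x = length (granules x)"

definition sources :: "input \<Rightarrow> (nat \<times> nat) list" where
  "sources x = filter (\<lambda>p. snd p \<noteq> sink (fst x)) (terminals x)"

definition ball_entry :: "input \<Rightarrow> nat \<times> nat \<Rightarrow> nat \<Rightarrow> (nat, nat) entry" where
  "ball_entry x p m =
    (dist_ball (select (fst p) (commodities x) (dist_tables x)) (snd p) (granularity x) m, p)"

definition initial_family :: "input \<Rightarrow> (nat, nat) entry list" where
  "initial_family x =
    concat (map (\<lambda>p. map (ball_entry x p) (rev [0..<granularity x])) (sources x))"

text \<open>One more than \<open>n\<^sup>2\<close> per initial entry. The potential of an entry is
  at most \<open>n\<^sup>2\<close>, and the additional head makes the comparison strict.\<close>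

definition fuel :: "input \<Rightarrow> nat list" where
  "fuel x = 0 # units_times (initial_family x) (units_times (vertex_list x) (vertex_list x))"

definition final_family :: "input \<Rightarrow> (nat, nat) entry list" where
  "final_family x = fold (\<lambda>_. uncross_pass) (fuel x) (initial_family x)"

definition encoded_family :: "input \<Rightarrow> data" where
  "encoded_family x = enc_list (map (\<lambda>A. Node (enc_nats (fst A)) (Node (enc_nat (fst (snd A)))
    (Node (Atom 1) (enc_nat (granularity x))))) (final_family x))"

section \<open>Running time of building the initial family\<close>

lemma polytime_granules: "polytime enc_in D (\<lambda>x. enc_nats (granules x))"
  unfolding granules_def
  by (rule polytime_units_times[OF polytime_vertex_list
        polytime_units_times[OF polytime_commodities polytime_commodities]])

lemma polytime_granularity: "polytime enc_in D (\<lambda>x. enc_nat (granularity x))"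
  using polytime_proj1[OF polytime_count[OF polytime_granules]] by (simp add: granularity_def)

lemma polytime_sources: "polytime enc_in D (\<lambda>x. enc_list (map (enc_pair enc_nat enc_nat) (sources x)))"
  unfolding sources_def
  by (rule polytime_filter[OF polytime_terminals polytime_not[OF polytime_eq_nat[OF
        polytime_proj2[OF polytime_snd] polytime_fst[OF polytime_sink[of UNIV]]]]]) simp

lemma polytime_initial_family: "polytime enc_in D (\<lambda>x. enc_entries (initial_family x))"
proof -
  let ?ep = "enc_pair enc_in (enc_pair enc_nat enc_nat)"
  let ?em = "enc_pair ?ep enc_nat"
  have lift: "polytime enc_in UNIV h \<Longrightarrow> polytime ?em E (\<lambda>y. h (fst (fst y)))" for h E
    by (rule polytime_fst[OF polytime_fst[where D' = UNIV]]) auto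
  have p: "polytime ?em E (\<lambda>y. enc_pair enc_nat enc_nat (snd (fst y)))" for E
    by (rule polytime_fst[OF polytime_snd[where D' = UNIV]]) simp
  have "polytime ?em E (\<lambda>y. enc_entry (ball_entry (fst (fst y)) (snd (fst y)) (snd y)))" for E
  proof -
    have t: "polytime ?em E (\<lambda>y. enc_list (map enc_dist (select (fst (snd (fst y)))
        (commodities (fst (fst y))) (dist_tables (fst (fst y))))))"
      by (rule polytime_select[OF polytime_proj1[OF p] lift[OF polytime_commodities]
          lift[OF polytime_dist_tables]]) (simp add: commodities_def dist_tables_def)
    show ?thesis
      unfolding ball_entry_def enc_entry_def
      by (rule polytime_Pair[where ea = enc_nats and eb = "enc_pair enc_nat enc_nat", OF _ p])
         (rule polytime_dist_ball[OF t polytime_proj2[OF p] lift[OF polytime_granularity] polytime_snd])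
  qed
  moreover have "polytime ?ep E (\<lambda>y. enc_nats (rev [0..<granularity (fst y)]))" for E
    unfolding granularity_def
    by (rule polytime_fst[where h = "\<lambda>x. enc_nats (rev [0..<length (granules x)])" and D = UNIV])
       (use polytime_proj2[OF polytime_count[OF polytime_granules]] in simp_all)
  ultimately have "polytime ?ep E (\<lambda>y. enc_list (map (\<lambda>m. enc_entry (ball_entry (fst y) (snd y) m))
      (rev [0..<granularity (fst y)])))" for E
    by (intro polytime_map[where ea = enc_nat and l = "\<lambda>y. rev [0..<granularity (fst y)]" and
          g = "\<lambda>y m. enc_entry (ball_entry (fst y) (snd y) m)"])
  then have "polytime enc_in D (\<lambda>x. enc_list (concat (map (\<lambda>p. map (\<lambda>m. enc_entry (ball_entry x p m))
      (rev [0..<granularity x])) (sources x))))"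
    by (rule polytime_concat_map[where g = "\<lambda>x p. map (\<lambda>m. enc_entry (ball_entry x p m))
      (rev [0..<granularity x])", OF polytime_sources])
  then show ?thesis
    by (simp add: initial_family_def map_concat comp_def)
qed

lemma polytime_fuel: "polytime enc_in D (\<lambda>x. enc_nats (fuel x))"
proof -
  have "polytime enc_in D (\<lambda>x. enc_nats (units_times (initial_family x) (units_times (vertex_list x) (vertex_list x))))"
    by (rule polytime_units_times[OF polytime_initial_family
          polytime_units_times[OF polytime_vertex_list polytime_vertex_list]])
  moreover have "polytime enc_in D (\<lambda>x. enc_nat 0)"
    by (simp add: enc_nat_def polytime_Atom)
  ultimately show ?thesis
    using polytime_Cons by (simp add: fuel_def)
qed

subsection \<open>Correctness\<close>

lemma sum_list_concat: "sum_list (concat xss) = (\<Sum>xs\<leftarrow>xss. sum_list xs)"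
  by (induction xss) simp_all

text \<open>The counted numbers lie in the half-open range between the ceilings of the two
  thresholds, which exceeds their distance by at most 1. This is the rounding loss of the grid of
  radii.\<close>

lemma card_between:
  fixes \<alpha> \<beta> :: real
  assumes "0 \<le> \<alpha>" "0 \<le> \<beta>"
  shows "real (card {m. m < M \<and> (\<alpha> \<le> real m \<longleftrightarrow> \<not> \<beta> \<le> real m)}) \<le> \<bar>\<alpha> - \<beta>\<bar> + 1"
  using assms
proof (induction \<alpha> \<beta> rule: linorder_wlog)
  case (le \<alpha> \<beta>)
  have "{m. m < M \<and> (\<alpha> \<le> real m \<longleftrightarrow> \<not> \<beta> \<le> real m)} \<subseteq> {nat \<lceil>\<alpha>\<rceil>..<nat \<lceil>\<beta>\<rceil>}"
    using le by (auto simp: nat_le_iff ceiling_le_iff zless_nat_eq_int_zless less_ceiling_iff)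
  then have "card {m. m < M \<and> (\<alpha> \<le> real m \<longleftrightarrow> \<not> \<beta> \<le> real m)} \<le> nat \<lceil>\<beta>\<rceil> - nat \<lceil>\<alpha>\<rceil>"
    using card_mono[OF finite_atLeastLessThan] by fastforce
  also have "real (nat \<lceil>\<beta>\<rceil> - nat \<lceil>\<alpha>\<rceil>) \<le> \<bar>\<alpha> - \<beta>\<bar> + 1"
    using le ceiling_mono[of \<alpha> \<beta>] by linarith
  finally show ?case
    by simp
next
  case (sym \<alpha> \<beta>)
  have "{m. m < M \<and> (\<alpha> \<le> real m \<longleftrightarrow> \<not> \<beta> \<le> real m)} = {m. m < M \<and> (\<beta> \<le> real m \<longleftrightarrow> \<not> \<alpha> \<le> real m)}"
    by auto
  with sym show ?case
    by (simp add: abs_minus_commute)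
qed

locale valid_input =
  fixes x :: input
  assumes valid: "x \<in> inputs"
begin

abbreviation "I \<equiv> fst x"
abbreviation "d \<equiv> snd x"
abbreviation "V \<equiv> verts I"
abbreviation "t \<equiv> sink I"
abbreviation "k \<equiv> ncom I"
abbreviation "N \<equiv> granularity x"
abbreviation "U \<equiv> V - {t}"

text \<open>Any commodity containing \<open>i\<close> would do; the last one is what
  \<open>select\<close> finds.\<close>

definition commodity :: "nat \<Rightarrow> nat" where
  "commodity i = last (filter (\<lambda>a. i \<in> com I a) [0..<k])"

lemma is_cscp: "is_cscp I"
  using valid by (simp add: inputs_def)

lemma finite_verts [simp]: "finite V" "finite U"
  using is_cscp by (auto simp: is_cscp_def)

lemma sink_in_verts: "t \<in> V"
  using is_cscp by (auto simp: is_cscp_def)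

lemma card_U: "card U + 1 = card V"
  using sink_in_verts card_Suc_Diff1[OF finite_verts(1) sink_in_verts] by simp

lemma vertex_list: "set (vertex_list x) = V" "distinct (vertex_list x)" "length (vertex_list x) = card V"
  by (simp_all add: vertex_list_def)

lemma finite_com: "a < k \<Longrightarrow> finite (com I a)"
  using is_cscp by (auto simp: is_cscp_def intro: card_ge_0_finite)

lemma granularity: "N = card V * k * k"
  by (simp add: granularity_def granules_def length_units_times vertex_list commodities_def)

lemma d_symm: "a < k \<Longrightarrow> u \<in> V \<Longrightarrow> v \<in> V \<Longrightarrow> 0 \<le> d a u v \<and> d a u v = d a v u"
  and d_refl: "a < k \<Longrightarrow> v \<in> V \<Longrightarrow> d a v v = 0"
  and d_triangle: "a < k \<Longrightarrow> u \<in> V \<Longrightarrow> v \<in> V \<Longrightarrow> w \<in> V \<Longrightarrow> d a u v \<le> d a u w + d a w v"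
  and d_terminals: "a < k \<Longrightarrow> i \<in> com I a \<Longrightarrow> j \<in> com I a \<Longrightarrow> i \<noteq> j \<Longrightarrow> 1 \<le> d a (loc I i) (loc I j)"
  and d_capacity: "{u, v} \<in> edges I \<Longrightarrow> real_of_rat (\<Sum>a<k. d a u v) \<le> real (cap I {u, v})"
  using valid unfolding inputs_def mcp_lp_feasible_def
  by (auto simp: of_rat_sum of_rat_less_eq simp flip: of_rat_add)

lemma finite_all_terminals: "finite (all_terminals I)"
  using finite_com by (auto simp: all_terminals_def)

lemma finite_source_terminals: "finite (source_terminals I)"
  using finite_all_terminals by (simp add: source_terminals_def)

lemma set_sources: "set (sources x) = (\<lambda>i. (i, loc I i)) ` source_terminals I"
  using finite_all_terminals by (auto simp: sources_def terminals_def source_terminals_def)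

lemma distinct_sources: "distinct (map fst (sources x))"
proof -
  have "map fst (sources x) = filter (\<lambda>i. loc I i \<noteq> t) (sorted_list_of_set (all_terminals I))"
    by (simp add: sources_def terminals_def filter_map comp_def)
  then show ?thesis
    by simp
qed

lemma commodity:
  assumes "i \<in> source_terminals I"
  shows "commodity i < k" "i \<in> com I (commodity i)"
proof -
  have "filter (\<lambda>a. i \<in> com I a) [0..<k] \<noteq> []"
    using assms by (auto simp: source_terminals_def all_terminals_def filter_empty_conv)
  then have "commodity i \<in> set (filter (\<lambda>a. i \<in> com I a) [0..<k])"
    unfolding commodity_def by (rule last_in_set)
  then show "commodity i < k" "i \<in> com I (commodity i)"
    by auto
qed

lemma source_props:
  assumes "i \<in> source_terminals I"
  shows "loc I i \<in> V" "loc I i \<noteq> t" "1 \<le> d (commodity i) (loc I i) t"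
proof -
  note a = commodity[OF assms]
  show *: "loc I i \<in> V" "loc I i \<noteq> t"
    using is_cscp a assms by (auto simp: is_cscp_def source_terminals_def)
  obtain j where j: "j \<in> com I (commodity i)" "loc I j = t"
    using is_cscp a(1) by (auto simp: is_cscp_def)
  then show "1 \<le> d (commodity i) (loc I i) t"
    using d_terminals[OF a j(1)] *(2) by auto
qed

text \<open>One of the two members of a commodity resides at the sink, which leaves room for only
  one source. So the distances chosen for different terminals are different summands of the capacity
  constraint, even if commodities share terminals.\<close>

lemma inj_on_commodity: "inj_on commodity (source_terminals I)"
proof (rule inj_onI)
  fix i j assume ij: "i \<in> source_terminals I" "j \<in> source_terminals I" "commodity i = commodity j"
  let ?S = "com I (commodity i)"
  have S: "card ?S = 2" and "\<exists>l\<in>?S. loc I l = t"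
    using is_cscp commodity(1)[OF ij(1)] by (auto simp: is_cscp_def)
  then obtain l where l: "l \<in> ?S" "loc I l = t"
    by blast
  have "i \<noteq> l" "j \<noteq> l" "i \<in> ?S" "j \<in> ?S"
    using source_props(2) l commodity(2) ij by fastforce+
  then show "i = j"
    using S l(1) by (auto simp: card_2_iff)
qed

lemma ball_entry:
  assumes "i \<in> source_terminals I"
  shows "ball_entry x (i, loc I i) m =
    (filter (\<lambda>v. d (commodity i) (loc I i) v * of_nat N \<le> of_nat m) (vertex_list x), (i, loc I i))"
proof -
  have com: "set (sorted_list_of_set (com I a)) = com I a" if "a < k" for a
    using finite_com[OF that] by simp
  have "select i (commodities x) (dist_tables x) =
      dist_table x (last (filter (\<lambda>a. i \<in> set (sorted_list_of_set (com I a))) [0..<k]))"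
    unfolding commodities_def dist_tables_def
    by (rule select_map[of "commodity i"]) (use commodity[OF assms] com in auto)
  also have "filter (\<lambda>a. i \<in> set (sorted_list_of_set (com I a))) [0..<k] = filter (\<lambda>a. i \<in> com I a) [0..<k]"
    by (rule filter_cong) (use com in auto)
  finally have "select i (commodities x) (dist_tables x) = dist_table x (commodity i)"
    by (simp add: commodity_def)
  then show ?thesis
    using source_props(1)[OF assms] vertex_list
    by (simp add: ball_entry_def dist_table_def dist_ball_table)
qed

lemma entries_ok_initial: "entries_ok U (set (sources x)) (initial_family x)"
proof
  fix A assume "A \<in> set (initial_family x)"
  then obtain i m where i: "i \<in> source_terminals I" and m: "m < N" and A: "A = ball_entry x (i, loc I i) m"
    by (auto simp: initial_family_def set_sources)
  note a = commodity(1)[OF i] and r = source_props[OF i]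
  \<comment> \<open>Here \<open>m < N\<close> matters: the radius is below 1, while the sink is at
    distance at least 1.\<close>
  have "\<not> d (commodity i) (loc I i) t * of_nat N \<le> of_nat m"
  proof
    assume "d (commodity i) (loc I i) t * of_nat N \<le> of_nat m"
    moreover have "1 * of_nat N \<le> d (commodity i) (loc I i) t * of_nat N"
      using r(3) by (intro mult_right_mono) auto
    ultimately have "of_nat N \<le> (of_nat m :: rat)"
      by simp
    with m show False
      by simp
  qed
  then show "entry_ok U (set (sources x)) A"
    using r d_refl[OF a r(1)] vertex_list i unfolding A ball_entry[OF i]
    by (auto simp: entry_ok_def set_sources)
qed

lemma entries_ok_final: "entries_ok U (set (sources x)) (final_family x)"
  unfolding final_family_def by (rule entries_ok_passes[OF entries_ok_initial])

lemma noncrossing_final: "noncrossing (final_family x)"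
  unfolding final_family_def
proof (rule noncrossing_passes_of_potential[OF finite_verts(2) entries_ok_initial])
  show "total_potential U (initial_family x) < length (fuel x)"
    using total_potential_le[OF finite_verts(2) entries_ok_initial]
    by (simp add: fuel_def length_units_times vertex_list card_U[simplified])
qed

text \<open>A duplicate-free list of vertices has an encoding no larger than that of all vertices,
  in whatever order uncrossing has left it.\<close>

lemma dsize_entry_le:
  assumes "entry_ok U (set (sources x)) A"
  shows "dsize (enc_entry A) \<le> 1 + dsize (enc_nats (vertex_list x)) +
    dsize (enc_list (map (enc_pair enc_nat enc_nat) (sources x)))"
proof -
  have "(\<Sum>v\<in>set (fst A). 1 + dsize (enc_nat v)) \<le> (\<Sum>v\<in>set (vertex_list x). 1 + dsize (enc_nat v))"
    using assms vertex_list by (intro sum_mono2) (auto simp: entry_ok_def)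
  then have "dsize (enc_nats (fst A)) \<le> dsize (enc_nats (vertex_list x))"
    using assms vertex_list(2)
    by (simp add: dsize_enc_list entry_ok_def comp_def sum_list_distinct_conv_sum_set)
  moreover have "dsize (enc_pair enc_nat enc_nat (snd A)) \<le>
      dsize (enc_list (map (enc_pair enc_nat enc_nat) (sources x)))"
    using assms by (intro dsize_mem_le) (auto simp: entry_ok_def)
  ultimately show ?thesis
    unfolding enc_entry_def by (subst enc_pair_def) simp
qed

section \<open>Weights, loads and feasibility of the output\<close>

definition family :: "(nat, nat) family" where
  "family = map (\<lambda>A. (set (fst A), fst (snd A), 1 / real N)) (final_family x)"

lemma N_pos: "i \<in> source_terminals I \<Longrightarrow> 0 < N"
  using commodity(1)[of i] sink_in_verts by (auto simp: granularity card_gt_0_iff)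

lemma final_entry:
  assumes "A \<in> set (final_family x)"
  shows "fst (snd A) \<in> source_terminals I" "loc I (fst (snd A)) \<in> set (fst A)" "set (fst A) \<subseteq> V" "t \<notin> set (fst A)"
  using entries_ok_final assms by (auto simp: entry_ok_def set_sources)

lemma represents_encoded_family: "represents_family (encoded_family x) family"
  unfolding represents_family_def encoded_family_def family_def
proof (intro exI conjI)
  have "represents_entry (Node (enc_nats (fst A)) (Node (enc_nat (fst (snd A)))
      (Node (Atom 1) (enc_nat N)))) (set (fst A), fst (snd A), 1 / real N)"
    if "A \<in> set (final_family x)" for A
    unfolding represents_entry_def enc_nat_def[of N] prod.case
    using N_pos[OF final_entry(1)[OF that]] by (intro exI[of _ "fst A"] exI[of _ 1] exI[of _ "int N"]) auto
  then show "list_all2 represents_entry (map (\<lambda>A. Node (enc_nats (fst A)) (Node (enc_nat (fst (snd A)))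
      (Node (Atom 1) (enc_nat N)))) (final_family x))
    (map (\<lambda>A. (set (fst A), fst (snd A), 1 / real N)) (final_family x))"
    by (auto simp: list_all2_map1 list_all2_map2 intro: list.rel_refl_strong)
qed (rule refl)

lemma weight_family:
  assumes "i \<in> source_terminals I"
  shows "(\<Sum>(C, j, w)\<leftarrow>family. if j = i then w else 0) = 1"
proof -
  let ?w = "\<lambda>p :: nat \<times> nat. if fst p = i then 1 / real N else 0"
  have "(\<Sum>(C, j, w)\<leftarrow>family. if j = i then w else 0) = (\<Sum>p\<leftarrow>map snd (final_family x). ?w p)"
    by (simp add: family_def comp_def)
  \<comment> \<open>The sum depends only on the multiset of terminals, which the passes
    preserve.\<close>
  also have "\<dots> = (\<Sum>p\<leftarrow>map snd (initial_family x). ?w p)"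
    unfolding sum_mset_sum_list[symmetric] mset_map[of ?w] final_family_def mset_passes ..
  also have "\<dots> = (\<Sum>p\<leftarrow>sources x. real N * ?w p)"
    by (simp add: initial_family_def ball_entry_def map_concat comp_def sum_list_concat sum_list_triv)
  also have "\<dots> = (\<Sum>j\<leftarrow>map fst (sources x). if j = i then 1 else 0)"
    using N_pos[OF assms] by (simp add: comp_def if_distrib cong: if_cong)
  also have "\<dots> = (\<Sum>j\<in>fst ` set (sources x). if j = i then 1 else 0)"
    using distinct_sources by (subst sum_list_distinct_conv_sum_set) auto
  also have "\<dots> = 1"
    using assms finite_source_terminals by (simp add: set_sources image_image)
  finally show ?thesis .
qed

text \<open>The ball with index \<open>m\<close> separates \<open>u\<close> from \<open>v\<close>
  iff \<open>m\<close> lies between the scaled distances of the two from the terminal. By the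
  triangle inequality these differ by at most \<open>N\<close> times the distance of
  \<open>u\<close> and \<open>v\<close>.\<close>

lemma separation_balls:
  assumes i: "i \<in> source_terminals I" and uv: "u \<in> V" "v \<in> V"
  shows "real (\<Sum>m\<leftarrow>rev [0..<N]. separates u v (ball_entry x (i, loc I i) m))
    \<le> real N * real_of_rat (d (commodity i) u v) + 1"
proof -
  let ?d = "\<lambda>w. d (commodity i) (loc I i) w"
  let ?r = "\<lambda>w. real_of_rat (?d w) * real N"
  note a = commodity(1)[OF i] and r = source_props(1)[OF i]
  have le: "q * of_nat N \<le> of_nat m \<longleftrightarrow> real_of_rat q * real N \<le> real m" for q m
    by (metis of_rat_less_eq of_rat_mult of_rat_of_nat_eq)
  have sep: "separates u v (ball_entry x (i, loc I i) m) = (if ?r u \<le> real m \<longleftrightarrow> \<not> ?r v \<le> real m then 1 else 0)" for m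
    using uv by (simp add: ball_entry[OF i] separates_def vertex_list le)
  have "(\<Sum>m\<leftarrow>rev [0..<N]. separates u v (ball_entry x (i, loc I i) m)) =
      card {m. m < N \<and> (?r u \<le> real m \<longleftrightarrow> \<not> ?r v \<le> real m)}"
    unfolding sep by (subst sum_list_distinct_conv_sum_set) (auto simp: sum.If_cases Int_def)
  also have "real \<dots> \<le> \<bar>?r u - ?r v\<bar> + 1"
    using d_symm[OF a r uv(1)] d_symm[OF a r uv(2)]
    by (intro card_between mult_nonneg_nonneg) (auto simp only: zero_le_of_rat_iff of_nat_0_le_iff)
  also have "\<bar>?r u - ?r v\<bar> = real N * real_of_rat \<bar>?d u - ?d v\<bar>"
    by (simp add: of_rat_diff abs_mult flip: left_diff_distrib abs_of_rat)
  also have "\<bar>?d u - ?d v\<bar> \<le> d (commodity i) u v"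
    using d_triangle[OF a r uv(1) uv(2)] d_triangle[OF a r uv(2) uv(1)] d_symm[OF a uv] by linarith
  finally show ?thesis
    by (simp add: mult_left_mono of_rat_less_eq)
qed

lemma load_family:
  assumes "e \<in> edges I"
  shows "load (edges I) family e \<le> real (cap I e) + 1 / real (card V * k)"
proof -
  obtain u v where e: "e = {u, v}" "u \<noteq> v" and uv: "u \<in> V" "v \<in> V"
    using is_cscp assms by (auto simp: is_cscp_def card_2_iff dest!: bspec)
  let ?T = "source_terminals I"
  have kT: "card ?T \<le> k"
    using card_inj_on_le[OF inj_on_commodity, of "{..<k}"] commodity(1) by auto
  have cut: "e \<in> cut_edges (edges I) C \<longleftrightarrow> (u \<in> C \<longleftrightarrow> v \<notin> C)" for C
    using assms e by (auto simp: cut_edges_def card_insert_if Int_insert_left)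
  have "(\<Sum>(C, i, w)\<leftarrow>map (\<lambda>A. (set (fst A), fst (snd A), 1 / real N)) F. if u \<in> C \<longleftrightarrow> v \<notin> C then w else 0) =
      real (separation u v F) / real N" for F :: "(nat, nat) entry list"
    by (induction F) (auto simp: separates_def add_divide_distrib)
  then have "load (edges I) family e = real (separation u v (final_family x)) / real N"
    unfolding load_def family_def cut .
  also have "separation u v (final_family x) \<le> separation u v (initial_family x)"
    unfolding final_family_def by (rule separation_passes)
  also have "separation u v (initial_family x) =
      (\<Sum>i\<leftarrow>map fst (sources x). \<Sum>m\<leftarrow>rev [0..<N]. separates u v (ball_entry x (i, loc I i) m))"
    unfolding initial_family_def by (auto simp: sum_list_concat map_concat comp_def set_sources
        intro!: arg_cong[where f = sum_list])
  also have "\<dots> = (\<Sum>i\<in>?T. \<Sum>m\<leftarrow>rev [0..<N]. separates u v (ball_entry x (i, loc I i) m))"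
    by (subst sum_list_distinct_conv_sum_set[OF distinct_sources]) (simp add: set_sources image_image)
  also have "real \<dots> \<le> (\<Sum>i\<in>?T. real N * real_of_rat (d (commodity i) u v) + 1)"
    unfolding of_nat_sum by (intro sum_mono separation_balls uv)
  also have "\<dots> = real N * (\<Sum>i\<in>?T. real_of_rat (d (commodity i) u v)) + card ?T"
    by (simp add: sum.distrib sum_distrib_left)
  \<comment> \<open>Injectivity turns the sum over terminals into one over different commodities;
    the missing commodities are then added as nonnegative terms.\<close>
  also have "(\<Sum>i\<in>?T. real_of_rat (d (commodity i) u v)) = (\<Sum>a\<in>commodity ` ?T. real_of_rat (d a u v))"
    by (simp add: sum.reindex[OF inj_on_commodity])
  also have "\<dots> \<le> (\<Sum>a<k. real_of_rat (d a u v))"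
    using commodity(1) d_symm uv by (intro sum_mono2) auto
  also have "\<dots> \<le> cap I e"
    using d_capacity assms by (simp add: e(1) of_rat_sum)
  finally have "load (edges I) family e \<le> (real N * cap I e + card ?T) / real N"
    by (simp add: divide_right_mono mult_left_mono)
  also have "\<dots> \<le> (real N * cap I e + k) / real N"
    using kT by (intro divide_right_mono) auto
  \<comment> \<open>Since \<open>N\<close> is \<open>card V * k * k\<close>, the fraction
    \<open>k / N\<close> is \<open>1 / (card V * k)\<close>. If \<open>N = 0\<close>, all quotients
    are 0.\<close>
  also have "\<dots> \<le> real (cap I e) + 1 / real (card V * k)"
    by (cases "N = 0") (auto simp: granularity add_divide_distrib)
  finally show ?thesis .
qed

lemma feasible_family: "family_feasible I (\<lambda>e. real (cap I e) + 1 / real (card V * k)) family"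
proof -
  have "laminar (fst ` set family)"
    using noncrossing_final by (auto simp: laminar_def family_def noncrossing_def crossing_iff_cross)
  then show ?thesis
    \<comment> \<open>Each set of the family is a proper cut: its terminal makes it nonempty and the
      sink is missing from it.\<close>
    using final_entry weight_family load_family sink_in_verts
    by (fastforce simp: family_feasible_def fractional_laminar_family_def family_def is_cut_def)
qed

end

lemma polytime_encoded_family: "polytime enc_in inputs encoded_family"
proof -
  let ?b = "\<lambda>x. 1 + dsize (enc_nats (vertex_list x)) +
    dsize (enc_list (map (enc_pair enc_nat enc_nat) (sources x)))"
  have F: "polytime enc_in inputs (\<lambda>x. enc_entries (final_family x))"
    unfolding final_family_def
  proof (rule polytime_passes[OF _ _ polytime_initial_family _ polytime_fuel])
    show "poly_bounded enc_in inputs ?b"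
      by (intro poly_bounded_intros polytime_imp_poly_bounded[OF polytime_vertex_list]
          polytime_imp_poly_bounded[OF polytime_sources])
    show "dsize (enc_entry A) \<le> ?b x"
      if "x \<in> inputs" "entry_ok (verts (fst x) - {sink (fst x)}) (set (sources x)) A" for x A
      using valid_input.dsize_entry_le[OF valid_input.intro] that by blast
    show "entries_ok (verts (fst x) - {sink (fst x)}) (set (sources x)) (initial_family x)"
      if "x \<in> inputs" for x
      by (rule valid_input.entries_ok_initial[OF valid_input.intro[OF that]])
  qed
  have A: "polytime (enc_pair enc_in enc_entry) E (\<lambda>y. enc_entry (snd y))" for E
    by (rule polytime_snd)
  note A' = polytime_proj1[OF A[unfolded enc_entry_def]]
    polytime_proj1[OF polytime_proj2[OF A[unfolded enc_entry_def]]]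
  show ?thesis
    unfolding encoded_family_def
    by (intro polytime_map[OF F] polytime_Node polytime_Atom A'[folded enc_entry_def]
        polytime_fst[OF polytime_granularity[of UNIV]]) simp
qed

theorem lemma1:
  shows "\<exists>(P :: program) (\<epsilon> :: nat \<Rightarrow> real).
    (\<forall>N. 0 \<le> \<epsilon> N) \<and> \<epsilon> \<longlonglongrightarrow> 0 \<and>
    poly_time_on P
      {enc_input I d | I d. is_cscp I \<and> mcp_lp_feasible I (\<lambda>a u v. of_rat (d a u v))} \<and>
    (\<forall>(I :: (nat, nat) cscp) (d :: nat \<Rightarrow> nat \<Rightarrow> nat \<Rightarrow> rat).
       is_cscp I \<and> mcp_lp_feasible I (\<lambda>a u v. of_rat (d a u v)) \<longrightarrow>
       (\<exists>y s F. runs P (enc_input I d) y s \<and> represents_family y F \<and>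
          family_feasible I (\<lambda>e. real (cap I e) + \<epsilon> (card (verts I) * ncom I)) F))"
proof -
  obtain P c s where P: "poly_bounded enc_in inputs c" "\<And>x. x \<in> inputs \<Longrightarrow> s x \<le> c x"
    "\<And>x. x \<in> inputs \<Longrightarrow> runs P (enc_in x) (encoded_family x) (s x)"
    using polytime_encoded_family by (rule polytimeE) blast
  obtain p where p: "\<And>x. x \<in> inputs \<Longrightarrow> c x \<le> poly p (dsize (enc_in x))"
    using P(1) unfolding poly_bounded_def by blast
  have "poly_time_on P {enc_input I d | I d. is_cscp I \<and> mcp_lp_feasible I (\<lambda>a u v. of_rat (d a u v))}"
    unfolding poly_time_on_def
  proof (intro exI[of _ p] ballI)
    fix z assume "z \<in> {enc_input I d | I d. is_cscp I \<and> mcp_lp_feasible I (\<lambda>a u v. of_rat (d a u v))}"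
    then obtain x where x: "x \<in> inputs" "z = enc_in x"
      by (force simp: inputs_def enc_in_def)
    then show "\<exists>y s. runs P z y s \<and> s \<le> poly p (dsize z)"
      using P(2,3)[OF x(1)] p[OF x(1)] le_trans by blast
  qed
  moreover have "\<exists>y s F. runs P (enc_input I d) y s \<and> represents_family y F \<and>
      family_feasible I (\<lambda>e. real (cap I e) + 1 / real (card (verts I) * ncom I)) F"
    if "is_cscp I \<and> mcp_lp_feasible I (\<lambda>a u v. of_rat (d a u v))" for I d
  proof -
    have x: "(I, d) \<in> inputs"
      using that by (simp add: inputs_def)
    then interpret valid_input "(I, d)"
      by unfold_locales
    show ?thesis
      using P(3)[OF x] represents_encoded_family feasible_family by (auto simp: enc_in_def)
  qed
  \<comment> \<open>The error function is \<open>1 / N\<close>; at 0 it has the value 0, so it is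
    nonnegative everywhere.\<close>
  ultimately show ?thesis
    by (intro exI[of _ P] exI[of _ "\<lambda>N. 1 / real N"]) (auto intro: lim_1_over_n)
qed

end
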